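(* Let $a,b>0$, $\gamma,\widetilde\gamma\in\mathbb{R}$, $\theta_2\in[-\pi,\pi]$, and put $\tau=\cos\theta_2$. Let $E\in(0,\infty)\setminus\sigma(\mathscr{H}_\gamma^{\theta_2})$ and $k=E^{1/2}$. Then $E\in\sigma_{\rm disc}(\mathscr{H}_{\gamma,\widetilde\gamma}^{\theta_2})$ if and only if $$ f_{\widetilde\gamma}^\tau(k)=\begin{cases} f_\gamma^\tau(k)+\sqrt{(f_\gamma^\tau(k))^2-1}, & \text{provided } f_\gamma^\tau(k)<-1,\\[2pt] f_\gamma^\tau(k)-\sqrt{(f_\gamma^\tau(k))^2-1}, & \text{provided } f_\gamma^\tau(k)>1.\end{cases} $$
   Context: Let $\Gamma_0$ be the infinite comb graph with vertices $x_j=(ja,0)$, $j\in\mathbb{Z}$, edges of length $a$ joining $x_{j-1}$ and $x_j$, and, for each $j$, two edges of length $b/2$ joining $x_j$ to $x_j^+=(ja,b/2)$ and to $x_j^-=(ja,-b/2)$. For $\gamma,\widetilde\gamma\in\mathbb{R}$ and $\theta_2\in[-\pi,\pi]$, $\mathscr{H}_{\gamma,\widetilde\gamma}^{\theta_2}$ is the self-adjoint operator in $L^2(\Gamma_0)$ acting as $-\frac{d^2}{dx^2}$ on each edge (functions in $H^2$ on each edge), with a $\delta$-coupling at each internal vertex $x_j$ (continuity of $\psi$ at $x_j$, and the sum of the derivatives of $\psi$ at $x_j$ taken in the outward directions of the edges emanating from $x_j$ equals $c_j\psi(x_j)$), where $c_0=\widetilde\gamma$ and $c_j=\gamma$ for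 $j\neq0$, and with the quasi-periodic conditions $\psi(x_j^+)=e^{i\theta_2}\psi(x_j^-)$, $\psi'(x_j^+)=e^{i\theta_2}\psi'(x_j^-)$ at the degree-one vertices (derivatives on the vertical edges taken with respect to the upward coordinate). Set $\mathscr{H}_\gamma^{\theta_2}:=\mathscr{H}_{\gamma,\gamma}^{\theta_2}$. Let $\Xi=\{k>0:\ \sin(ka)\sin(kb)=0\}$ and, for $\gamma\in\mathbb{R}$, $\tau\in[-1,1]$, define $f_\gamma^\tau:(0,\infty)\setminus\Xi\to\mathbb{R}$ by $$f_\gamma^\tau(k)=\frac{\gamma\sin ka}{2k}+\frac{\sin k(a+b)}{\sin kb}-\tau\frac{\sin ka}{\sin kb}.$$ For $E=k^2>0$ one has $E\in\sigma(\mathscr{H}_\gamma^{\theta_2})$ iff $|f_\gamma^{\cos\theta_2}(k)|\le1$; in particular $E\in(0,\infty)\setminus\sigma(\mathscr{H}_\gamma^{\theta_2})$ means $|f_\gamma^{\cos\theta_2}(k)|>1$. *)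

theory Defs
  imports "HOL-Analysis.Analysis"
begin

text \<open>Edges of the comb graph: for each j :: int there is the horizontal edge
 (Hor, j) of length a joining x_(j-1) (parameter 0) to x_j (parameter a), the upper
 vertical edge (Up, j) of length b/2 joining x_j (parameter 0) to x_j^+ (parameter b/2),
 and the lower vertical edge (Dn, j) of length b/2 joining x_j^- (parameter 0) to x_j
 (parameter b/2); vertical edges are parametrised by the upward coordinate.
 A function on the graph is psi :: int => etype => real => complex, psi j e restricted
 to [0, elen a b e].\<close>

datatype etype = Hor | Up | Dn

definition elen :: "real \<Rightarrow> real \<Rightarrow> etype \<Rightarrow> real" where
  "elen a b e = (case e of Hor \<Rightarrow> a | Up \<Rightarrow> b / 2 | Dn \<Rightarrow> b / 2)"

definition sqint :: "real \<Rightarrow> (real \<Rightarrow> complex) \<Rightarrow> bool" where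
  "sqint l u \<longleftrightarrow> set_borel_measurable lborel {0..l} u \<and>
     set_integrable lborel {0..l} (\<lambda>t. (cmod (u t))^2)"

text \<open>u belongs to H^2(0,l) and w is (a representative of) its second derivative:
 u is C^1 on [0,l] and u' is the indefinite Lebesgue integral of the L^2 function w.\<close>
definition H2sol :: "real \<Rightarrow> (real \<Rightarrow> complex) \<Rightarrow> (real \<Rightarrow> complex) \<Rightarrow> bool" where
  "H2sol l u w \<longleftrightarrow> sqint l w \<and>
     (\<exists>u'. (\<forall>t\<in>{0..l}. (u has_vector_derivative u' t) (at t within {0..l})) \<and>
           (\<forall>t\<in>{0..l}. u' t = u' 0 + (LINT s:{0..t}|lborel. w s)))"

definition edge_norm2 :: "real \<Rightarrow> (real \<Rightarrow> complex) \<Rightarrow> real" where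
  "edge_norm2 l u = (LINT t:{0..l}|lborel. (cmod (u t))^2)"

definition L2g :: "real \<Rightarrow> real \<Rightarrow> (int \<Rightarrow> etype \<Rightarrow> real \<Rightarrow> complex) \<Rightarrow> bool" where
  "L2g a b psi \<longleftrightarrow> (\<forall>j e. sqint (elen a b e) (psi j e)) \<and>
     (\<lambda>j. edge_norm2 a (psi j Hor) + edge_norm2 (b/2) (psi j Up) + edge_norm2 (b/2) (psi j Dn))
        summable_on (UNIV :: int set)"

definition dv :: "real \<Rightarrow> (real \<Rightarrow> complex) \<Rightarrow> real \<Rightarrow> complex" where
  "dv l u t = vector_derivative u (at t within {0..l})"

definition vertex_conds ::
  "real \<Rightarrow> real \<Rightarrow> (int \<Rightarrow> real) \<Rightarrow> real \<Rightarrow> (int \<Rightarrow> etype \<Rightarrow> real \<Rightarrow> complex) \<Rightarrow> bool" where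
  "vertex_conds a b c theta psi \<longleftrightarrow> (\<forall>j::int.
      psi j Hor a = psi (j+1) Hor 0 \<and> psi (j+1) Hor 0 = psi j Up 0 \<and> psi j Up 0 = psi j Dn (b/2) \<and>
      - dv a (psi j Hor) a + dv a (psi (j+1) Hor) 0 + dv (b/2) (psi j Up) 0 - dv (b/2) (psi j Dn) (b/2)
        = complex_of_real (c j) * psi j Up 0 \<and>
      psi j Up (b/2) = exp (\<i> * complex_of_real theta) * psi j Dn 0 \<and>
      dv (b/2) (psi j Up) (b/2) = exp (\<i> * complex_of_real theta) * dv (b/2) (psi j Dn) 0)"

text \<open>psi is in the operator domain and (H - E) psi = g (i.e. -psi'' = g + E psi on each edge)\<close>
definition solves ::
  "real \<Rightarrow> real \<Rightarrow> (int \<Rightarrow> real) \<Rightarrow> real \<Rightarrow> complex \<Rightarrow> (int \<Rightarrow> etype \<Rightarrow> real \<Rightarrow> complex)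
     \<Rightarrow> (int \<Rightarrow> etype \<Rightarrow> real \<Rightarrow> complex) \<Rightarrow> bool" where
  "solves a b c theta E psi g \<longleftrightarrow> L2g a b psi \<and>
     (\<forall>j e. H2sol (elen a b e) (psi j e) (\<lambda>t. - (g j e t + E * psi j e t))) \<and>
     vertex_conds a b c theta psi"

definition zero_on_edges :: "real \<Rightarrow> real \<Rightarrow> (int \<Rightarrow> etype \<Rightarrow> real \<Rightarrow> complex) \<Rightarrow> bool" where
  "zero_on_edges a b psi \<longleftrightarrow> (\<forall>j e. \<forall>t\<in>{0..elen a b e}. psi j e t = 0)"

text \<open>spectrum: E is in the resolvent set iff H - E is a bijection from the domain onto
 L^2 (for the closed operator H the inverse is then automatically bounded)\<close>
definition specH :: "real \<Rightarrow> real \<Rightarrow> (int \<Rightarrow> real) \<Rightarrow> real \<Rightarrow> complex set" where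
  "specH a b c theta = {E. \<not> ((\<forall>g. L2g a b g \<longrightarrow> (\<exists>psi. solves a b c theta E psi g)) \<and>
      (\<forall>psi. solves a b c theta E psi (\<lambda>_ _ _. 0) \<longrightarrow> zero_on_edges a b psi))}"

definition eigsp :: "real \<Rightarrow> real \<Rightarrow> (int \<Rightarrow> real) \<Rightarrow> real \<Rightarrow> complex
    \<Rightarrow> (int \<Rightarrow> etype \<Rightarrow> real \<Rightarrow> complex) set" where
  "eigsp a b c theta E = {psi. solves a b c theta E psi (\<lambda>_ _ _. 0)}"

definition disc_specH :: "real \<Rightarrow> real \<Rightarrow> (int \<Rightarrow> real) \<Rightarrow> real \<Rightarrow> complex set" where
  "disc_specH a b c theta = {E \<in> specH a b c theta.
     (\<exists>\<epsilon>>0. \<forall>\<mu>. \<mu> \<noteq> E \<and> cmod (\<mu> - E) < \<epsilon> \<longrightarrow> \<mu> \<notin> specH a b c theta) \<and>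
     (\<exists>psi\<in>eigsp a b c theta E. \<not> zero_on_edges a b psi) \<and>
     (\<exists>F. finite F \<and> F \<subseteq> eigsp a b c theta E \<and>
        (\<forall>psi\<in>eigsp a b c theta E. \<exists>co. \<forall>j e. \<forall>t\<in>{0..elen a b e}.
            psi j e t = (\<Sum>phi\<in>F. co phi * phi j e t)))}"

definition coup :: "real \<Rightarrow> real \<Rightarrow> int \<Rightarrow> real" where
  "coup \<gamma> \<gamma>t j = (if j = 0 then \<gamma>t else \<gamma>)"

definition specHg :: "real \<Rightarrow> real \<Rightarrow> real \<Rightarrow> real \<Rightarrow> real \<Rightarrow> complex set" where
  "specHg a b \<gamma> \<gamma>t theta = specH a b (coup \<gamma> \<gamma>t) theta"

definition disc_specHg :: "real \<Rightarrow> real \<Rightarrow> real \<Rightarrow> real \<Rightarrow> real \<Rightarrow> complex set" where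
  "disc_specHg a b \<gamma> \<gamma>t theta = disc_specH a b (coup \<gamma> \<gamma>t) theta"

definition Xi :: "real \<Rightarrow> real \<Rightarrow> real set" where
  "Xi a b = {k. k > 0 \<and> sin (k * a) * sin (k * b) = 0}"

definition ff :: "real \<Rightarrow> real \<Rightarrow> real \<Rightarrow> real \<Rightarrow> real \<Rightarrow> real" where
  "ff a b \<gamma> \<tau> k = \<gamma> * sin (k * a) / (2 * k) + sin (k * (a + b)) / sin (k * b)
      - \<tau> * sin (k * a) / sin (k * b)"

end

theory Submission
  imports Defs "HOL-Complex_Analysis.Complex_Analysis"
begin

text \<open>On an edge every solution of \<open>- u'' = g + \<kappa>\<^sup>2 u\<close> is a particular solution plus a combination of
  \<open>cos \<kappa>t\<close> and \<open>sin \<kappa>t / \<kappa>\<close>. Eliminating the edges turns \<open>(H - \<kappa>\<^sup>2) \<psi> = g\<close> into the three-term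
  recurrence \<open>y (j + 1) + y (j - 1) - 2 F\<^sub>j y j = h j\<close> for the vertex values \<open>y j = \<psi> (x\<^sub>j)\<close>, where
  \<open>F\<^sub>j\<close> is the discriminant \<open>f\<close> for the coupling at \<open>x\<^sub>j\<close>. If \<open>F\<close> lies outside \<open>[-1, 1]\<close>, let \<open>z\<close> be
  the root of \<open>z + 1/z = 2 F\<close> with \<open>|z| < 1\<close>. A decaying solution of the homogeneous recurrence is
  a multiple of \<open>z\<^bsup>|j|\<^esup>\<close>, which satisfies the equation at \<open>j = 0\<close> exactly when \<open>Ft = z\<close>; otherwise
  the recurrence is uniquely solvable in \<open>\<ell>\<^sup>2\<close> and \<open>\<kappa>\<^sup>2\<close> is in the resolvent set. If \<open>F \<in> [-1, 1]\<close>
  there are no decaying solutions on a half-line, so a source at a single vertex has no response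
  and \<open>\<kappa>\<^sup>2\<close> is in the spectrum of the unperturbed operator. The equation \<open>Ft = z\<close> forces an entire
  function of \<open>\<kappa>\<close> to vanish which is nonzero far up the imaginary axis; hence the eigenvalue is isolated.\<close>

text \<open>The spectrum is defined by bijectivity of H - E for each complex E, and discreteness
  asks for a punctured complex disc of resolvent points. The reduction is therefore carried out for
  complex \<kappa>, not only for real k. Eliminating the edges divides by sin \<kappa>a and sin
  \<kappa>b, whence the exclusion of \<open>Xi\<close>.

  Elimination has to respect square-integrability in both directions, with constants shared by
  infinitely many edges. End values of particular solutions are bounded by the L^2 norm of the
  source, and edge functions by source and initial data; conversely an L^2 bound on a vertical edge
  controls the vertex value. The latter yields decay of the vertex values, and decay is all that
  uniqueness requires.

  The two cases of the theorem are the choice of sign in F +- sqrt (F^2 - 1) that gives the root of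
  modulus below 1. For isolation this branch is awkward to follow as \<kappa> varies. Inserting Ft
  for z in z^2 - 2 F z + 1 = 0 removes it and leads to an entire function. Its zeros may also come
  from the other root, which is harmless because only its nonvanishing near k is used.\<close>

definition cs :: "complex \<Rightarrow> real \<Rightarrow> complex" where
  "cs \<kappa> t = cos (\<kappa> * of_real t)"

text \<open>The factor \<open>1 / \<kappa>\<close> normalises the slope at 0 to 1 and makes
  \<open>sn\<close>, like \<open>cs\<close>, even in \<kappa>, so that both depend on the energy
  \<kappa>^2 alone.\<close>

definition sn :: "complex \<Rightarrow> real \<Rightarrow> complex" where
  "sn \<kappa> t = sin (\<kappa> * of_real t) / \<kappa>"

lemma cs_0 [simp]: "cs \<kappa> 0 = 1" and sn_0 [simp]: "sn \<kappa> 0 = 0"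
  by (simp_all add: cs_def sn_def)

lemma cs_has_vector_derivative:
  assumes "\<kappa> \<noteq> 0"
  shows "(cs \<kappa> has_vector_derivative - \<kappa>\<^sup>2 * sn \<kappa> t) (at t within S)"
proof -
  have "((\<lambda>z. cos (\<kappa> * z)) has_field_derivative - sin (\<kappa> * of_real t) * \<kappa>) (at (of_real t))"
    by (auto intro!: derivative_eq_intros)
  from has_vector_derivative_real_field[OF this, of S] show ?thesis
    using assms by (simp add: cs_def[abs_def] sn_def power2_eq_square mult.commute)
qed

lemma sn_has_vector_derivative:
  assumes "\<kappa> \<noteq> 0"
  shows "(sn \<kappa> has_vector_derivative cs \<kappa> t) (at t within S)"
proof -
  have "((\<lambda>z. sin (\<kappa> * z) / \<kappa>) has_field_derivative cos (\<kappa> * of_real t)) (at (of_real t))"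
    using assms by (auto intro!: derivative_eq_intros)
  from has_vector_derivative_real_field[OF this, of S] show ?thesis
    by (simp add: cs_def sn_def[abs_def])
qed

lemma continuous_on_cs: "continuous_on S (cs \<kappa>)" and continuous_on_sn: "continuous_on S (sn \<kappa>)"
  unfolding cs_def[abs_def] sn_def[abs_def] divide_inverse by (intro continuous_intros)+

lemma cs_sn_square:
  assumes "\<kappa> \<noteq> 0"
  shows "(cs \<kappa> t)\<^sup>2 + \<kappa>\<^sup>2 * (sn \<kappa> t)\<^sup>2 = 1"
  using assms by (simp add: cs_def sn_def power_divide)

lemma cs_double: "\<kappa> \<noteq> 0 \<Longrightarrow> cs \<kappa> b = (cs \<kappa> (b/2))\<^sup>2 - \<kappa>\<^sup>2 * (sn \<kappa> (b/2))\<^sup>2"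
  using cos_double[of "\<kappa> * of_real (b/2)"] by (simp add: cs_def sn_def power_divide)

lemma sn_double: "sn \<kappa> b = 2 * cs \<kappa> (b/2) * sn \<kappa> (b/2)"
  using sin_double[of "\<kappa> * of_real (b/2)"] by (simp add: cs_def sn_def)

subsection \<open>Solutions on a single edge\<close>

text \<open>With \<open>G = \<integral>g\<close> and \<open>w = u' + G\<close> the equation \<open>- u'' = g + \<kappa>\<^sup>2 u\<close> becomes the \<open>C\<^sup>1\<close> system
  \<open>u' = w - G\<close>, \<open>w' = - \<kappa>\<^sup>2 u\<close>; \<open>psol\<close> is its solution with zero initial data.\<close>

definition prim :: "(real \<Rightarrow> complex) \<Rightarrow> real \<Rightarrow> complex" where
  "prim g t = integral {0..t} g"

text \<open>Duhamel's integral of \<open>- sn \<kappa> (t - s) * g s\<close> over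
  \<open>{0..t}\<close>, integrated by parts to the integral of
  \<open>- cs \<kappa> (t - s) * prim g s\<close>; the addition theorem then separates s from t. The
  integrands become continuous even if g is not.\<close>

definition psol :: "complex \<Rightarrow> (real \<Rightarrow> complex) \<Rightarrow> real \<Rightarrow> complex" where
  "psol \<kappa> g t = - (cs \<kappa> t * prim (\<lambda>s. cs \<kappa> s * prim g s) t
                  + \<kappa>\<^sup>2 * sn \<kappa> t * prim (\<lambda>s. sn \<kappa> s * prim g s) t)"

definition psol' :: "complex \<Rightarrow> (real \<Rightarrow> complex) \<Rightarrow> real \<Rightarrow> complex" where
  "psol' \<kappa> g t = \<kappa>\<^sup>2 * (sn \<kappa> t * prim (\<lambda>s. cs \<kappa> s * prim g s) t
                  - cs \<kappa> t * prim (\<lambda>s. sn \<kappa> s * prim g s) t) - prim g t"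

lemma prim_0 [simp]: "prim g 0 = 0"
  by (simp add: prim_def)

lemma psol_0 [simp]: "psol \<kappa> g 0 = 0" and psol'_0 [simp]: "psol' \<kappa> g 0 = 0"
  by (simp_all add: psol_def psol'_def)

lemma prim_zero [simp]: "prim (\<lambda>_. 0) t = 0"
  by (simp add: prim_def)

lemma psol_zero [simp]: "psol \<kappa> (\<lambda>_. 0) t = 0" and psol'_zero [simp]: "psol' \<kappa> (\<lambda>_. 0) t = 0"
  by (simp_all add: psol_def psol'_def)

lemma continuous_on_prim: "g integrable_on {0..l} \<Longrightarrow> continuous_on {0..l} (prim g)"
  unfolding prim_def[abs_def] by (rule indefinite_integral_continuous_1)

lemma prim_has_vector_derivative:
  "continuous_on {0..l} g \<Longrightarrow> t \<in> {0..l} \<Longrightarrow> (prim g has_vector_derivative g t) (at t within {0..l})"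
  unfolding prim_def[abs_def] by (rule integral_has_vector_derivative)

text \<open>For merely integrable g the function \<open>psol'\<close> inherits the roughness of
  \<open>prim g\<close>. Adding \<open>prim g\<close> cancels it, so the second-order equation is
  expressed through the derivative of that sum.\<close>

lemma psol_has_vector_derivative:
  assumes "\<kappa> \<noteq> 0" "g integrable_on {0..l}" "t \<in> {0..l}"
  shows "(psol \<kappa> g has_vector_derivative psol' \<kappa> g t) (at t within {0..l})"
    and "((\<lambda>t. psol' \<kappa> g t + prim g t) has_vector_derivative - \<kappa>\<^sup>2 * psol \<kappa> g t) (at t within {0..l})"
proof -
  let ?A = "prim (\<lambda>s. cs \<kappa> s * prim g s)" and ?B = "prim (\<lambda>s. sn \<kappa> s * prim g s)"
  have A: "(?A has_vector_derivative cs \<kappa> t * prim g t) (at t within {0..l})"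
    by (rule prim_has_vector_derivative[OF _ assms(3)])
      (intro continuous_intros continuous_on_cs continuous_on_prim assms)
  have B: "(?B has_vector_derivative sn \<kappa> t * prim g t) (at t within {0..l})"
    by (rule prim_has_vector_derivative[OF _ assms(3)])
      (intro continuous_intros continuous_on_sn continuous_on_prim assms)
  note C = cs_has_vector_derivative[OF assms(1)] and S = sn_has_vector_derivative[OF assms(1)]
  have "(psol \<kappa> g has_vector_derivative
     - ((cs \<kappa> t * (cs \<kappa> t * prim g t) + (- \<kappa>\<^sup>2 * sn \<kappa> t) * ?A t)
       + (\<kappa>\<^sup>2 * sn \<kappa> t * (sn \<kappa> t * prim g t) + \<kappa>\<^sup>2 * cs \<kappa> t * ?B t))) (at t within {0..l})"
    unfolding psol_def[abs_def]
    by (intro has_vector_derivative_minus has_vector_derivative_add has_vector_derivative_mult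
        A B C has_vector_derivative_mult_right S)
  moreover have "- ((cs \<kappa> t * (cs \<kappa> t * prim g t) + (- \<kappa>\<^sup>2 * sn \<kappa> t) * ?A t)
       + (\<kappa>\<^sup>2 * sn \<kappa> t * (sn \<kappa> t * prim g t) + \<kappa>\<^sup>2 * cs \<kappa> t * ?B t))
     = \<kappa>\<^sup>2 * (sn \<kappa> t * ?A t - cs \<kappa> t * ?B t) - ((cs \<kappa> t)\<^sup>2 + \<kappa>\<^sup>2 * (sn \<kappa> t)\<^sup>2) * prim g t"
    by (simp add: algebra_simps power2_eq_square)
  ultimately show "(psol \<kappa> g has_vector_derivative psol' \<kappa> g t) (at t within {0..l})"
    by (simp add: psol'_def cs_sn_square[OF assms(1)])
  have "((\<lambda>t. \<kappa>\<^sup>2 * (sn \<kappa> t * ?A t - cs \<kappa> t * ?B t)) has_vector_derivative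
     \<kappa>\<^sup>2 * ((sn \<kappa> t * (cs \<kappa> t * prim g t) + cs \<kappa> t * ?A t)
       - (cs \<kappa> t * (sn \<kappa> t * prim g t) + (- \<kappa>\<^sup>2 * sn \<kappa> t) * ?B t))) (at t within {0..l})"
    by (intro has_vector_derivative_diff has_vector_derivative_mult
        A B C has_vector_derivative_mult_right S)
  moreover have "\<kappa>\<^sup>2 * ((sn \<kappa> t * (cs \<kappa> t * prim g t) + cs \<kappa> t * ?A t)
       - (cs \<kappa> t * (sn \<kappa> t * prim g t) + (- \<kappa>\<^sup>2 * sn \<kappa> t) * ?B t)) = - \<kappa>\<^sup>2 * psol \<kappa> g t"
    by (simp add: algebra_simps psol_def)
  ultimately show "((\<lambda>t. psol' \<kappa> g t + prim g t) has_vector_derivative - \<kappa>\<^sup>2 * psol \<kappa> g t) (at t within {0..l})"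
    by (simp add: psol'_def)
qed

section \<open>Square-integrable functions on an edge and their primitives\<close>

lemma sqint_set_integrable:
  assumes "sqint l g"
  shows "set_integrable lborel {0..l} g"
proof -
  have 1: "set_integrable lborel {0..l} (\<lambda>t. 1 + (cmod (g t))\<^sup>2)"
    using assms borel_integrable_atLeastAtMost'[of 0 l "\<lambda>_. 1 :: real"]
    by (intro set_integral_add) (auto simp: sqint_def)
  show ?thesis
  proof (rule set_integrable_bound[OF 1])
    show "set_borel_measurable lborel {0..l} g" using assms by (simp add: sqint_def)
    have "cmod x \<le> 1 + (cmod x)\<^sup>2" for x
      using sum_squares_ge_zero[of "cmod x - 1/2" 0] by (simp add: power2_eq_square algebra_simps)
    then show "AE x in lborel. x \<in> {0..l} \<longrightarrow> norm (g x) \<le> norm (1 + (cmod (g x))\<^sup>2)"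
      by (auto simp: abs_of_nonneg)
  qed
qed

lemma sqint_continuous:
  assumes "continuous_on {0..l} u"
  shows "sqint l u"
proof -
  have "continuous_on {0..l} (\<lambda>t. (cmod (u t))\<^sup>2)" by (intro continuous_intros assms)
  from borel_integrable_atLeastAtMost'[OF this] show ?thesis
    using borel_integrable_atLeastAtMost'[OF assms]
    by (auto simp: sqint_def set_borel_measurable_def set_integrable_def)
qed

text \<open>Links the Lebesgue integral in \<open>H2sol\<close> to the gauge integral behind
  \<open>prim\<close>, on which the calculus of this part is based.\<close>

lemma set_lebesgue_integral_eq_prim:
  assumes "set_integrable lborel {0..l} g" "t \<in> {0..l}"
  shows "(LINT s:{0..t}|lborel. g s) = prim g t"
  unfolding prim_def
  by (rule set_borel_integral_eq_integral(2)) (rule set_integrable_subset[OF assms(1)], use assms in auto)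

lemma edge_norm2_nonneg: "0 \<le> edge_norm2 l u"
  unfolding edge_norm2_def set_lebesgue_integral_def by (rule integral_nonneg_AE) auto

lemma prim_bound:
  assumes "sqint l g" "t \<in> {0..l}" and lp: "l > 0"
  shows "(cmod (prim g t))\<^sup>2 \<le> l * edge_norm2 l g"
proof -
  have i: "set_integrable lborel {0..l} g" by (rule sqint_set_integrable[OF assms(1)])
  have i2: "set_integrable lborel {0..l} (\<lambda>t. cmod (g t))" by (rule set_integrable_norm[OF i])
  have i3: "set_integrable lborel {0..l} (\<lambda>t. (cmod (g t))\<^sup>2)" using assms by (simp add: sqint_def)
  let ?I = "LINT s:{0..l}|lborel. cmod (g s)"
  have I0: "0 \<le> ?I" unfolding set_lebesgue_integral_def by (rule integral_nonneg_AE) auto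
  have "cmod (prim g t) = cmod (LINT s:{0..t}|lborel. g s)"
    by (simp add: set_lebesgue_integral_eq_prim[OF i assms(2)])
  also have "\<dots> \<le> (LINT s:{0..t}|lborel. cmod (g s))"
    by (rule set_integral_norm_bound) (rule set_integrable_subset[OF i], use assms in auto)
  also have "\<dots> \<le> ?I"
    unfolding set_lebesgue_integral_def
    apply (rule integral_mono)
    using set_integrable_subset[OF i2, of "{0..t}"] i2 assms(2)
    by (auto simp: set_integrable_def indicator_def)
  finally have le: "cmod (prim g t) \<le> ?I" .
  have CS: "?I\<^sup>2 \<le> l * edge_norm2 l g"
  proof -
    \<comment> \<open>Cauchy-Schwarz against the constant 1: m is the mean of |g|, which minimises
      the integral of (|g| - m)^2; expanding this nonnegative integral gives the bound.\<close>
    define m where "m = ?I / l"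
    have "0 \<le> (LINT s:{0..l}|lborel. (cmod (g s) - m)\<^sup>2)"
      unfolding set_lebesgue_integral_def by (rule integral_nonneg_AE) auto
    also have "\<dots> = (LINT s:{0..l}|lborel. (cmod (g s))\<^sup>2 - 2 * m * cmod (g s) + m\<^sup>2)"
      by (simp add: power2_diff algebra_simps)
    also have "\<dots> = edge_norm2 l g - 2 * m * ?I + (LINT s:{0..l}|lborel. m\<^sup>2)"
    proof -
      have i4: "set_integrable lborel {0..l} (\<lambda>s. m\<^sup>2)"
        by (rule borel_integrable_atLeastAtMost') auto
      have i5: "set_integrable lborel {0..l} (\<lambda>s. 2 * m * cmod (g s))"
        by (intro set_integrable_mult_right i2)
      show ?thesis
        unfolding edge_norm2_def
        using set_integral_add(2)[OF set_integral_diff(1)[OF i3 i5] i4] set_integral_diff(2)[OF i3 i5]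
        by simp
    qed
    also have "(LINT s:{0..l}|lborel. m\<^sup>2) = l * m\<^sup>2"
      using lp by (simp add: set_lebesgue_integral_def)
    finally show ?thesis using lp by (simp add: m_def field_simps power2_eq_square)
  qed
  have "(cmod (prim g t))\<^sup>2 \<le> ?I\<^sup>2" using le by (intro power_mono) auto
  with CS show ?thesis by simp
qed


lemma cmod_add_square_le: "(cmod (x + y))\<^sup>2 \<le> 2 * ((cmod x)\<^sup>2 + (cmod y)\<^sup>2)"
proof -
  have "(cmod (x + y))\<^sup>2 \<le> (cmod x + cmod y)\<^sup>2" by (intro power_mono norm_triangle_ineq) auto
  also have "\<dots> \<le> 2 * ((cmod x)\<^sup>2 + (cmod y)\<^sup>2)"
    using sum_squares_ge_zero[of "cmod x - cmod y" 0] by (simp add: power2_eq_square algebra_simps)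
  finally show ?thesis .
qed

lemma sqint_add:
  assumes "sqint l u" "sqint l v"
  shows "sqint l (\<lambda>t. u t + v t)"
proof -
  have m: "set_borel_measurable lborel {0..l} (\<lambda>t. u t + v t)"
    using assms unfolding sqint_def set_borel_measurable_def scaleR_add_right
    by (intro borel_measurable_add) simp_all
  have i: "set_integrable lborel {0..l} (\<lambda>t. 2 * ((cmod (u t))\<^sup>2 + (cmod (v t))\<^sup>2))"
    using assms by (intro set_integrable_mult_right set_integral_add) (auto simp: sqint_def)
  have "set_integrable lborel {0..l} (\<lambda>t. (cmod (u t + v t))\<^sup>2)"
  proof (rule set_integrable_bound[OF i])
    have "(\<lambda>x. (cmod (indicat_real {0..l} x *\<^sub>R (u x + v x)))\<^sup>2) \<in> borel_measurable lborel"
      by (rule borel_measurable_power[OF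
            measurable_compose[OF m[unfolded set_borel_measurable_def] borel_measurable_norm]])
    moreover have "(\<lambda>x. (cmod (indicat_real {0..l} x *\<^sub>R (u x + v x)))\<^sup>2)
      = (\<lambda>x. indicat_real {0..l} x *\<^sub>R (cmod (u x + v x))\<^sup>2)"
      by (intro ext) (simp add: indicator_def)
    ultimately show "set_borel_measurable lborel {0..l} (\<lambda>t. (cmod (u t + v t))\<^sup>2)"
      unfolding set_borel_measurable_def by (simp only:)
    show "AE x in lborel. x \<in> {0..l} \<longrightarrow> norm ((cmod (u x + v x))\<^sup>2) \<le> norm (2 * ((cmod (u x))\<^sup>2 + (cmod (v x))\<^sup>2))"
    proof (intro AE_I2 impI)
      fix x
      show "norm ((cmod (u x + v x))\<^sup>2) \<le> norm (2 * ((cmod (u x))\<^sup>2 + (cmod (v x))\<^sup>2))"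
        using cmod_add_square_le[of "u x" "v x"] by simp
    qed
  qed
  with m show ?thesis unfolding sqint_def by (rule conjI)
qed

lemma sqint_cmult:
  assumes "sqint l u"
  shows "sqint l (\<lambda>t. c * u t)"
proof -
  have m: "(\<lambda>x. indicat_real {0..l} x *\<^sub>R u x) \<in> borel_measurable lborel"
   and i: "set_integrable lborel {0..l} (\<lambda>t. (cmod (u t))\<^sup>2)"
    using assms unfolding sqint_def set_borel_measurable_def by simp_all
  have "(\<lambda>x. indicat_real {0..l} x *\<^sub>R (c * u x)) \<in> borel_measurable lborel"
    using borel_measurable_times[OF borel_measurable_const[of c] m] by (simp only: mult_scaleR_right)
  moreover have "set_integrable lborel {0..l} (\<lambda>t. (cmod (c * u t))\<^sup>2)"
    unfolding norm_mult power_mult_distrib by (rule set_integrable_mult_right) (rule i)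
  ultimately show ?thesis
    unfolding sqint_def set_borel_measurable_def by simp
qed

lemma sqint_minus: "sqint l u \<Longrightarrow> sqint l (\<lambda>t. - u t)"
  using sqint_cmult[of l u "-1"] by simp

lemma has_vector_derivative_continuous_on:
  "(\<And>t. t \<in> S \<Longrightarrow> (u has_vector_derivative u' t) (at t within S)) \<Longrightarrow> continuous_on S u"
  by (meson continuous_on_eq_continuous_within has_vector_derivative_continuous)

lemma dv_eq:
  assumes "(u has_vector_derivative d) (at t within {0..l})" "t \<in> {0..l}" "l > 0"
  shows "dv l u t = d"
  unfolding dv_def by (rule vector_derivative_within_closed_interval) (use assms in auto)

lemma prim_add: 
  assumes "f integrable_on {0..t}" "g integrable_on {0..t}"
  shows "prim (\<lambda>s. f s + g s) t = prim f t + prim g t"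
  unfolding prim_def using assms by (rule Henstock_Kurzweil_Integration.integral_add)

lemma prim_derivative:
  assumes "\<And>t. t \<in> {0..l} \<Longrightarrow> (u has_vector_derivative u' t) (at t within {0..l})" "t \<in> {0..l}"
  shows "prim u' t = u t - u 0"
  unfolding prim_def
proof (rule integral_unique, rule fundamental_theorem_of_calculus)
  show "0 \<le> t" using assms by auto
  show "(u has_vector_derivative u' s) (at s within {0..t})" if "s \<in> {0..t}" for s
    by (rule has_vector_derivative_within_subset[OF assms(1)]) (use assms(2) that in auto)
qed

lemma H2sol_iff:
  assumes "sqint l w"
  shows "H2sol l u w \<longleftrightarrow> (\<exists>u'. (\<forall>t\<in>{0..l}. (u has_vector_derivative u' t) (at t within {0..l})) \<and>
           (\<forall>t\<in>{0..l}. u' t = u' 0 + prim w t))"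
  using set_lebesgue_integral_eq_prim[OF sqint_set_integrable[OF assms]] assms
  unfolding H2sol_def by auto

section \<open>The general solution on an edge in terms of its initial data\<close>

definition esol :: "complex \<Rightarrow> (real \<Rightarrow> complex) \<Rightarrow> complex \<Rightarrow> complex \<Rightarrow> real \<Rightarrow> complex" where
  "esol \<kappa> g \<alpha> \<beta> t = psol \<kappa> g t + \<alpha> * cs \<kappa> t + \<beta> * sn \<kappa> t"

definition esol' :: "complex \<Rightarrow> (real \<Rightarrow> complex) \<Rightarrow> complex \<Rightarrow> complex \<Rightarrow> real \<Rightarrow> complex" where
  "esol' \<kappa> g \<alpha> \<beta> t = psol' \<kappa> g t - \<kappa>\<^sup>2 * \<alpha> * sn \<kappa> t + \<beta> * cs \<kappa> t"

lemma esol_0 [simp]: "esol \<kappa> g \<alpha> \<beta> 0 = \<alpha>" and esol'_0 [simp]: "esol' \<kappa> g \<alpha> \<beta> 0 = \<beta>"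
  by (simp_all add: esol_def esol'_def)

lemma sqint_integrable_on: "sqint l g \<Longrightarrow> g integrable_on {0..l}"
  using set_borel_integral_eq_integral(1) sqint_set_integrable by blast

lemma esol_has_vector_derivative:
  assumes "\<kappa> \<noteq> 0" "sqint l g" "t \<in> {0..l}"
  shows "(esol \<kappa> g \<alpha> \<beta> has_vector_derivative esol' \<kappa> g \<alpha> \<beta> t) (at t within {0..l})"
    and "((\<lambda>t. esol' \<kappa> g \<alpha> \<beta> t + prim g t) has_vector_derivative - \<kappa>\<^sup>2 * esol \<kappa> g \<alpha> \<beta> t) (at t within {0..l})"
proof -
  note P = psol_has_vector_derivative[OF assms(1) sqint_integrable_on[OF assms(2)] assms(3)]
  note C = has_vector_derivative_mult_right[OF cs_has_vector_derivative[OF assms(1)]]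
   and S = has_vector_derivative_mult_right[OF sn_has_vector_derivative[OF assms(1)]]
  have "(esol \<kappa> g \<alpha> \<beta> has_vector_derivative (psol' \<kappa> g t + \<alpha> * (- \<kappa>\<^sup>2 * sn \<kappa> t) + \<beta> * cs \<kappa> t)) (at t within {0..l})"
    unfolding esol_def[abs_def] by (intro has_vector_derivative_add P C S)
  then show "(esol \<kappa> g \<alpha> \<beta> has_vector_derivative esol' \<kappa> g \<alpha> \<beta> t) (at t within {0..l})"
    by (simp add: esol'_def algebra_simps)
  have "((\<lambda>t. (psol' \<kappa> g t + prim g t) + (- \<kappa>\<^sup>2 * \<alpha>) * sn \<kappa> t + \<beta> * cs \<kappa> t) has_vector_derivative
     (- \<kappa>\<^sup>2 * psol \<kappa> g t + (- \<kappa>\<^sup>2 * \<alpha>) * cs \<kappa> t + \<beta> * (- \<kappa>\<^sup>2 * sn \<kappa> t))) (at t within {0..l})"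
    by (intro has_vector_derivative_add P C S)
  then show "((\<lambda>t. esol' \<kappa> g \<alpha> \<beta> t + prim g t) has_vector_derivative - \<kappa>\<^sup>2 * esol \<kappa> g \<alpha> \<beta> t) (at t within {0..l})"
    by (simp add: esol_def esol'_def algebra_simps)
qed

lemma dv_esol:
  assumes "\<kappa> \<noteq> 0" "sqint l g" "t \<in> {0..l}" "l > 0"
  shows "dv l (esol \<kappa> g \<alpha> \<beta>) t = esol' \<kappa> g \<alpha> \<beta> t"
  by (rule dv_eq[OF esol_has_vector_derivative(1)[OF assms(1-3)] assms(3,4)])

lemma continuous_on_esol: "\<kappa> \<noteq> 0 \<Longrightarrow> sqint l g \<Longrightarrow> continuous_on {0..l} (esol \<kappa> g \<alpha> \<beta>)"
  by (rule has_vector_derivative_continuous_on[OF esol_has_vector_derivative(1)])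

lemma H2sol_esol:
  assumes "\<kappa> \<noteq> 0" "sqint l g"
  shows "H2sol l (esol \<kappa> g \<alpha> \<beta>) (\<lambda>t. - (g t + \<kappa>\<^sup>2 * esol \<kappa> g \<alpha> \<beta> t))"
proof -
  let ?u = "esol \<kappa> g \<alpha> \<beta>"
  have s1: "sqint l ?u" by (rule sqint_continuous[OF continuous_on_esol[OF assms]])
  have s: "sqint l (\<lambda>t. - (g t + \<kappa>\<^sup>2 * ?u t))"
    by (intro sqint_minus sqint_add sqint_cmult s1 assms)
  show ?thesis
    unfolding H2sol_iff[OF s]
  proof (intro exI[of _ "esol' \<kappa> g \<alpha> \<beta>"] conjI ballI)
    fix t assume t: "t \<in> {0..l}"
    show "(?u has_vector_derivative esol' \<kappa> g \<alpha> \<beta> t) (at t within {0..l})"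
      by (rule esol_has_vector_derivative(1)[OF assms t])
    have sub: "{0..t} \<subseteq> {0..l}" using t by auto
    have "prim (\<lambda>t. - (g t + \<kappa>\<^sup>2 * ?u t)) t = prim (\<lambda>t. - g t + - \<kappa>\<^sup>2 * ?u t) t"
      by (simp add: algebra_simps)
    also have "\<dots> = prim (\<lambda>t. - g t) t + prim (\<lambda>t. - \<kappa>\<^sup>2 * ?u t) t"
      by (intro prim_add integrable_on_subinterval[OF _ sub] sqint_integrable_on
        sqint_minus sqint_cmult s1 assms)
    also have "prim (\<lambda>t. - \<kappa>\<^sup>2 * ?u t) t = (esol' \<kappa> g \<alpha> \<beta> t + prim g t) - (esol' \<kappa> g \<alpha> \<beta> 0 + prim g 0)"
      by (rule prim_derivative[OF esol_has_vector_derivative(2)[OF assms] t])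
    also have "prim (\<lambda>t. - g t) t = - prim g t" by (simp add: prim_def)
    finally show "esol' \<kappa> g \<alpha> \<beta> t = esol' \<kappa> g \<alpha> \<beta> 0 + prim (\<lambda>t. - (g t + \<kappa>\<^sup>2 * ?u t)) t"
      by simp
  qed
qed

lemma H2sol_continuous_on:
  assumes "H2sol l u w"
  shows "continuous_on {0..l} u"
proof -
  obtain u' where "\<forall>t\<in>{0..l}. (u has_vector_derivative u' t) (at t within {0..l})"
    using assms unfolding H2sol_def by blast
  then show ?thesis by (intro has_vector_derivative_continuous_on[of _ u u']) simp
qed

lemma H2sol_has_vector_derivative:
  assumes "H2sol l u w" "t \<in> {0..l}" "l > 0"
  shows "(u has_vector_derivative dv l u t) (at t within {0..l})"
proof -
  obtain u' where "\<forall>t\<in>{0..l}. (u has_vector_derivative u' t) (at t within {0..l})"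
    using assms(1) unfolding H2sol_def by blast
  then have "(u has_vector_derivative u' t) (at t within {0..l})" using assms(2) by simp
  with dv_eq[OF this assms(2,3)] show ?thesis by simp
qed

lemma H2sol_diff:
  assumes "H2sol l u w" "H2sol l v w'"
  shows "H2sol l (\<lambda>t. u t - v t) (\<lambda>t. w t - w' t)"
proof -
  have s: "sqint l w" "sqint l w'" using assms unfolding H2sol_def by blast+
  have s': "sqint l (\<lambda>t. w t - w' t)" using sqint_add[OF s(1) sqint_minus[OF s(2)]] by simp
  from assms(1) obtain u' where u: "\<forall>t\<in>{0..l}. (u has_vector_derivative u' t) (at t within {0..l})"
     "\<forall>t\<in>{0..l}. u' t = u' 0 + prim w t" unfolding H2sol_iff[OF s(1)] by blast
  from assms(2) obtain v' where v: "\<forall>t\<in>{0..l}. (v has_vector_derivative v' t) (at t within {0..l})"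
     "\<forall>t\<in>{0..l}. v' t = v' 0 + prim w' t" unfolding H2sol_iff[OF s(2)] by blast
  show ?thesis
    unfolding H2sol_iff[OF s']
  proof (intro exI[of _ "\<lambda>t. u' t - v' t"] conjI ballI)
    fix t assume t: "t \<in> {0..l}"
    show "((\<lambda>t. u t - v t) has_vector_derivative u' t - v' t) (at t within {0..l})"
      using u(1) v(1) t by (intro has_vector_derivative_diff) simp_all
    have sub: "{0..t} \<subseteq> {0..l}" using t by auto
    have "prim (\<lambda>t. w t - w' t) t = prim w t - prim w' t"
      unfolding prim_def
      by (intro Henstock_Kurzweil_Integration.integral_diff integrable_on_subinterval[OF _ sub] sqint_integrable_on s)
    moreover have "u' t = u' 0 + prim w t" "v' t = v' 0 + prim w' t" using u(2) v(2) t by blast+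
    ultimately show "u' t - v' t = u' 0 - v' 0 + prim (\<lambda>t. w t - w' t) t" by simp
  qed
qed

text \<open>The Wronskians of u with \<open>sn\<close> and with \<open>cs\<close> (facts 1 and 2)
  are constant along the edge. As linear equations for u and u' they have determinant \<open>(cs
  \<kappa> t)\<^sup>2 + \<kappa>\<^sup>2 * (sn \<kappa> t)\<^sup>2 = 1\<close>, so the initial data
  determine both.\<close>

lemma H2sol_homogeneous_eq:
  assumes "\<kappa> \<noteq> 0" "l > 0" and H: "H2sol l u (\<lambda>t. - (\<kappa>\<^sup>2 * u t))" and t: "t \<in> {0..l}"
  shows "u t = esol \<kappa> (\<lambda>_. 0) (u 0) (dv l u 0) t"
    and "dv l u t = esol' \<kappa> (\<lambda>_. 0) (u 0) (dv l u 0) t"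
proof -
  have cu: "continuous_on {0..l} u" by (rule H2sol_continuous_on[OF H])
  have s: "sqint l (\<lambda>t. - (\<kappa>\<^sup>2 * u t))" using H unfolding H2sol_def by (rule conjunct1)
  from H obtain u' where u: "\<And>t. t\<in>{0..l} \<Longrightarrow> (u has_vector_derivative u' t) (at t within {0..l})"
     "\<And>t. t\<in>{0..l} \<Longrightarrow> u' t = u' 0 + prim (\<lambda>t. - (\<kappa>\<^sup>2 * u t)) t" unfolding H2sol_iff[OF s] by blast
  have dv: "dv l u t = u' t" if "t \<in> {0..l}" for t by (rule dv_eq[OF u(1)[OF that] that assms(2)])
  \<comment> \<open>Since \<open>- \<kappa>\<^sup>2 * u\<close> is continuous, the integral equation
    for u' can be differentiated at every point, and u is a classical solution.\<close>
  have u'd: "(u' has_vector_derivative - (\<kappa>\<^sup>2 * u t)) (at t within {0..l})" if t: "t \<in> {0..l}" for t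
  proof -
    have "((\<lambda>t. u' 0 + prim (\<lambda>t. - (\<kappa>\<^sup>2 * u t)) t) has_vector_derivative 0 + - (\<kappa>\<^sup>2 * u t)) (at t within {0..l})"
      by (intro has_vector_derivative_add has_vector_derivative_const prim_has_vector_derivative t continuous_intros cu)
    then have "((\<lambda>t. u' 0 + prim (\<lambda>t. - (\<kappa>\<^sup>2 * u t)) t) has_vector_derivative - (\<kappa>\<^sup>2 * u t)) (at t within {0..l})"
      by simp
    then show ?thesis by (rule has_vector_derivative_transform[OF t u(2), rotated])
  qed
  note C = cs_has_vector_derivative[OF assms(1)] and S = sn_has_vector_derivative[OF assms(1)]
  have c0: "D t = D 0" if "\<And>t. t \<in> {0..l} \<Longrightarrow> (D has_vector_derivative 0) (at t within {0..l})" for D :: "real \<Rightarrow> complex"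
    using prim_derivative[of l D "\<lambda>_. 0", OF that t] by simp
  have 1: "u t * cs \<kappa> t - u' t * sn \<kappa> t = u 0 * cs \<kappa> 0 - u' 0 * sn \<kappa> 0"
  proof (rule c0)
    fix t assume t: "t \<in> {0..l}"
    have "((\<lambda>t. u t * cs \<kappa> t - u' t * sn \<kappa> t) has_vector_derivative
      (u t * (- \<kappa>\<^sup>2 * sn \<kappa> t) + u' t * cs \<kappa> t) - (u' t * cs \<kappa> t + - (\<kappa>\<^sup>2 * u t) * sn \<kappa> t)) (at t within {0..l})"
      by (intro has_vector_derivative_diff has_vector_derivative_mult u(1) u'd t C S)
    then show "((\<lambda>t. u t * cs \<kappa> t - u' t * sn \<kappa> t) has_vector_derivative 0) (at t within {0..l})"
      by (simp add: algebra_simps)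
  qed
  have 2: "\<kappa>\<^sup>2 * (u t * sn \<kappa> t) + u' t * cs \<kappa> t = \<kappa>\<^sup>2 * (u 0 * sn \<kappa> 0) + u' 0 * cs \<kappa> 0"
  proof (rule c0)
    fix t assume t: "t \<in> {0..l}"
    have "((\<lambda>t. \<kappa>\<^sup>2 * (u t * sn \<kappa> t) + u' t * cs \<kappa> t) has_vector_derivative
      \<kappa>\<^sup>2 * (u t * cs \<kappa> t + u' t * sn \<kappa> t) + (u' t * (- \<kappa>\<^sup>2 * sn \<kappa> t) + - (\<kappa>\<^sup>2 * u t) * cs \<kappa> t)) (at t within {0..l})"
      by (intro has_vector_derivative_add has_vector_derivative_mult has_vector_derivative_mult_right u(1) u'd t C S)
    then show "((\<lambda>t. \<kappa>\<^sup>2 * (u t * sn \<kappa> t) + u' t * cs \<kappa> t) has_vector_derivative 0) (at t within {0..l})"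
      by (simp add: algebra_simps)
  qed
  have z: "0 \<in> {0..l}" using assms by simp
  have 3: "u t * ((cs \<kappa> t)\<^sup>2 + \<kappa>\<^sup>2 * (sn \<kappa> t)\<^sup>2) = u 0 * cs \<kappa> t + u' 0 * sn \<kappa> t"
    using 1 2 unfolding cs_0 sn_0 by algebra
  have 4: "u' t * ((cs \<kappa> t)\<^sup>2 + \<kappa>\<^sup>2 * (sn \<kappa> t)\<^sup>2) = u' 0 * cs \<kappa> t - \<kappa>\<^sup>2 * u 0 * sn \<kappa> t"
    using 1 2 unfolding cs_0 sn_0 by algebra
  show "u t = esol \<kappa> (\<lambda>_. 0) (u 0) (dv l u 0) t"
    using 3 by (simp add: esol_def dv[OF z] cs_sn_square[OF assms(1)])
  show "dv l u t = esol' \<kappa> (\<lambda>_. 0) (u 0) (dv l u 0) t"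
    using 4 by (simp add: esol'_def dv[OF z] dv[OF t] cs_sn_square[OF assms(1)])
qed


section \<open>Uniform bounds between edge solutions and their data\<close>

lemma edge_norm2_le:
  assumes "continuous_on {0..l} u" "l > 0" "\<And>t. t \<in> {0..l} \<Longrightarrow> (cmod (u t))\<^sup>2 \<le> B"
  shows "edge_norm2 l u \<le> l * B"
proof -
  have c: "continuous_on {0..l} (\<lambda>t. (cmod (u t))\<^sup>2)" by (intro continuous_intros assms)
  have "edge_norm2 l u = integral {0..l} (\<lambda>t. (cmod (u t))\<^sup>2)"
    unfolding edge_norm2_def
    by (rule set_borel_integral_eq_integral(2)[OF borel_integrable_atLeastAtMost'[OF c]])
  also have "\<dots> \<le> integral {0..l} (\<lambda>t. B)"
    by (intro integral_le integrable_continuous_interval c assms) auto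
  finally show ?thesis using assms(2) by simp
qed

lemma continuous_on_bound:
  fixes f :: "real \<Rightarrow> complex"
  assumes "continuous_on {0..l} f"
  obtains M where "M > 0" "\<And>t. t \<in> {0..l} \<Longrightarrow> cmod (f t) \<le> M"
proof -
  have "bounded (f ` {0..l})"
    by (rule compact_imp_bounded[OF compact_continuous_image[OF assms compact_Icc]])
  then obtain M where M: "M > 0" "\<forall>x\<in>f ` {0..l}. cmod x \<le> M" unfolding bounded_pos by blast
  show thesis by (rule that[OF M(1)]) (use M(2) in blast)
qed

text \<open>K is chosen before g. This uniformity turns an L^2 source on infinitely many edges into
  square-summable sequences of end values.\<close>

lemma psol_bound:
  assumes "\<kappa> \<noteq> 0" "l > 0"
  obtains K where "K > 0"
    "\<And>g t. sqint l g \<Longrightarrow> t \<in> {0..l} \<Longrightarrow> (cmod (psol \<kappa> g t))\<^sup>2 \<le> K * edge_norm2 l g"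
    "\<And>g t. sqint l g \<Longrightarrow> t \<in> {0..l} \<Longrightarrow> (cmod (psol' \<kappa> g t))\<^sup>2 \<le> K * edge_norm2 l g"
proof -
  obtain M1 where M1: "M1 > 0" "\<And>t. t \<in> {0..l} \<Longrightarrow> cmod (cs \<kappa> t) \<le> M1"
    using continuous_on_bound[OF continuous_on_cs] by blast
  obtain M2 where M2: "M2 > 0" "\<And>t. t \<in> {0..l} \<Longrightarrow> cmod (sn \<kappa> t) \<le> M2"
    using continuous_on_bound[OF continuous_on_sn] by blast
  define m where "m = (cmod \<kappa>)\<^sup>2"
  have m0: "m \<ge> 0" by (simp add: m_def)
  \<comment> \<open>Both constants collect a triangle inequality: R bounds \<open>prim g\<close>,
    and each inner integral contributes a factor M * l * R. The \<open>+ 1\<close> in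
    \<open>K2\<close> stands for the bare term \<open>- prim g t\<close> of
    \<open>psol'\<close>.\<close>
  define K1 where "K1 = M1 * (M1 * l) + m * (M2 * (M2 * l))"
  define K2 where "K2 = m * (M2 * (M1 * l) + M1 * (M2 * l)) + 1"
  have K0: "K1 \<ge> 0" "K2 > 0"
    using M1(1) M2(1) assms(2) m0 by (auto simp: K1_def K2_def intro!: add_nonneg_pos mult_nonneg_nonneg add_nonneg_nonneg)
  have main: "cmod (psol \<kappa> g t) \<le> K1 * sqrt (l * edge_norm2 l g)
     \<and> cmod (psol' \<kappa> g t) \<le> K2 * sqrt (l * edge_norm2 l g)" if g: "sqint l g" and t: "t \<in> {0..l}" for g t
  proof -
    define R where "R = sqrt (l * edge_norm2 l g)"
    have R0: "R \<ge> 0" using assms(2) by (simp add: R_def edge_norm2_nonneg)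
    have G: "cmod (prim g s) \<le> R" if "s \<in> {0..l}" for s
      unfolding R_def by (rule real_le_rsqrt[OF prim_bound[OF g that assms(2)]])
    have Gc: "continuous_on {0..l} (prim g)" by (rule continuous_on_prim[OF sqint_integrable_on[OF g]])
    have X: "cmod (prim (\<lambda>s. f s * prim g s) t) \<le> M * l * R"
      if f: "continuous_on {0..l} f" and M: "M > 0" "\<And>s. s \<in> {0..l} \<Longrightarrow> cmod (f s) \<le> M" for f M
    proof -
      have "cmod (prim (\<lambda>s. f s * prim g s) t) \<le> (M * R) * (t - 0)"
        unfolding prim_def
      proof (rule integral_bound)
        show "continuous_on {0..t} (\<lambda>s. f s * integral {0..s} g)"
          by (rule continuous_on_subset[OF continuous_on_mult[OF f Gc[unfolded prim_def[abs_def]]]]) (use t in auto)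
        show "norm (f s * integral {0..s} g) \<le> M * R" if "s \<in> {0..t}" for s
          unfolding norm_mult
          by (intro mult_mono M G[unfolded prim_def]) (use that t M in auto)
      qed (use t in auto)
      also have "\<dots> \<le> (M * R) * l" using t M R0 by (intro mult_left_mono) auto
      finally show ?thesis by (simp add: mult_ac)
    qed
    note A = X[OF continuous_on_cs M1] and B = X[OF continuous_on_sn M2]
    let ?A = "prim (\<lambda>s. cs \<kappa> s * prim g s) t" and ?B = "prim (\<lambda>s. sn \<kappa> s * prim g s) t"
    have p: "cmod (x * y) \<le> P * Q" if "cmod x \<le> P" "cmod y \<le> Q" for x y P Q
      unfolding norm_mult using that by (intro mult_mono) (auto intro: order_trans[OF norm_ge_zero])
    have kk: "cmod (\<kappa>\<^sup>2) \<le> m" by (simp add: m_def norm_power)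
    have "cmod (psol \<kappa> g t) \<le> cmod (cs \<kappa> t * ?A) + cmod (\<kappa>\<^sup>2 * (sn \<kappa> t * ?B))"
      unfolding psol_def norm_minus_cancel mult.assoc by (rule norm_triangle_ineq)
    also have "\<dots> \<le> M1 * (M1 * l * R) + m * (M2 * (M2 * l * R))"
      by (intro add_mono p kk A B M1 M2 t)
    finally have 1: "cmod (psol \<kappa> g t) \<le> K1 * R" by (simp add: K1_def algebra_simps)
    have "cmod (psol' \<kappa> g t) \<le> cmod (\<kappa>\<^sup>2 * (sn \<kappa> t * ?A - cs \<kappa> t * ?B)) + cmod (prim g t)"
      unfolding psol'_def by (rule norm_triangle_ineq4)
    also have "\<dots> \<le> m * (M2 * (M1 * l * R) + M1 * (M2 * l * R)) + R"
      by (intro add_mono p kk order_trans[OF norm_triangle_ineq4] A B M1 M2 t G)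
    finally have 2: "cmod (psol' \<kappa> g t) \<le> K2 * R" by (simp add: K2_def algebra_simps)
    show ?thesis using 1 2 by (simp add: R_def)
  qed
  define K where "K = (K1\<^sup>2 + K2\<^sup>2) * l"
  show thesis
  proof (rule that[of K])
    have "K2\<^sup>2 > 0" using K0 by simp
    then show "K > 0" using assms zero_le_power2[of K1] unfolding K_def by (intro mult_pos_pos) linarith+
    fix g t assume g: "sqint l g" and t: "t \<in> {0..l}"
    have n: "l * edge_norm2 l g \<ge> 0" using assms(2) by (simp add: edge_norm2_nonneg)
    have sq: "x\<^sup>2 \<le> K * edge_norm2 l g" if x: "0 \<le> x" "x \<le> k * sqrt (l * edge_norm2 l g)" and k: "k\<^sup>2 \<le> K1\<^sup>2 + K2\<^sup>2" for x k
    proof -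
      have "x\<^sup>2 \<le> (k * sqrt (l * edge_norm2 l g))\<^sup>2" by (rule power_mono[OF x(2,1)])
      also have "\<dots> = k\<^sup>2 * (l * edge_norm2 l g)" using n by (simp add: power_mult_distrib)
      also have "\<dots> \<le> (K1\<^sup>2 + K2\<^sup>2) * (l * edge_norm2 l g)" by (rule mult_right_mono[OF k n])
      finally show ?thesis by (simp add: K_def mult_ac)
    qed
    show "(cmod (psol \<kappa> g t))\<^sup>2 \<le> K * edge_norm2 l g"
      by (rule sq[of _ K1]) (use main[OF g t] in auto)
    show "(cmod (psol' \<kappa> g t))\<^sup>2 \<le> K * edge_norm2 l g"
      by (rule sq[of _ K2]) (use main[OF g t] in auto)
  qed
qed

text \<open>The way back from sequences to the graph: square-summable initial data and an L^2 source
  give an L^2 function, because K is shared by all edges of length l.\<close>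

lemma esol_norm_bound:
  assumes "\<kappa> \<noteq> 0" "l > 0"
  obtains K where "K > 0" "\<And>g \<alpha> \<beta>. sqint l g \<Longrightarrow>
    edge_norm2 l (esol \<kappa> g \<alpha> \<beta>) \<le> K * (edge_norm2 l g + (cmod \<alpha>)\<^sup>2 + (cmod \<beta>)\<^sup>2)"
proof -
  obtain M1 where M1: "M1 > 0" "\<And>t. t \<in> {0..l} \<Longrightarrow> cmod (cs \<kappa> t) \<le> M1"
    using continuous_on_bound[OF continuous_on_cs] by blast
  obtain M2 where M2: "M2 > 0" "\<And>t. t \<in> {0..l} \<Longrightarrow> cmod (sn \<kappa> t) \<le> M2"
    using continuous_on_bound[OF continuous_on_sn] by blast
  obtain K where K: "K > 0"
    "\<And>g t. sqint l g \<Longrightarrow> t \<in> {0..l} \<Longrightarrow> (cmod (psol \<kappa> g t))\<^sup>2 \<le> K * edge_norm2 l g"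
    using psol_bound[OF assms] by metis
  define L where "L = 4 * (K + M1\<^sup>2 + M2\<^sup>2)"
  have L0: "L > 0" using K(1) by (simp add: L_def add_pos_nonneg)
  show thesis
  proof (rule that[of "l * L"])
    show "l * L > 0" using L0 assms by simp
    fix g \<alpha> \<beta> assume g: "sqint l g"
    have n: "edge_norm2 l g \<ge> 0" by (rule edge_norm2_nonneg)
    have "edge_norm2 l (esol \<kappa> g \<alpha> \<beta>) \<le> l * (L * (edge_norm2 l g + (cmod \<alpha>)\<^sup>2 + (cmod \<beta>)\<^sup>2))"
    proof (rule edge_norm2_le[OF continuous_on_esol[OF assms(1) g] assms(2)])
      fix t assume t: "t \<in> {0..l}"
      have "(cmod (esol \<kappa> g \<alpha> \<beta> t))\<^sup>2 \<le> 2 * ((cmod (psol \<kappa> g t + \<alpha> * cs \<kappa> t))\<^sup>2 + (cmod (\<beta> * sn \<kappa> t))\<^sup>2)"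
        unfolding esol_def by (rule cmod_add_square_le)
      also have "(cmod (psol \<kappa> g t + \<alpha> * cs \<kappa> t))\<^sup>2 \<le> 2 * ((cmod (psol \<kappa> g t))\<^sup>2 + (cmod (\<alpha> * cs \<kappa> t))\<^sup>2)"
        by (rule cmod_add_square_le)
      also have "(cmod (psol \<kappa> g t))\<^sup>2 \<le> (K + M1\<^sup>2 + M2\<^sup>2) * edge_norm2 l g"
        by (rule order_trans[OF K(2)[OF g t]]) (rule mult_right_mono[OF _ n], simp)
      also have "(cmod (\<alpha> * cs \<kappa> t))\<^sup>2 \<le> (K + M1\<^sup>2 + M2\<^sup>2) * (cmod \<alpha>)\<^sup>2"
      proof -
        have "(cmod (cs \<kappa> t))\<^sup>2 \<le> M1\<^sup>2" using M1(2)[OF t] by (intro power_mono) auto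
        then have "(cmod (cs \<kappa> t))\<^sup>2 \<le> K + M1\<^sup>2 + M2\<^sup>2"
          using K(1) zero_le_power2[of M2] by linarith
        from mult_right_mono[OF this zero_le_power2[of "cmod \<alpha>"]]
        show ?thesis by (simp add: norm_mult power_mult_distrib mult.commute)
      qed
      also have "(cmod (\<beta> * sn \<kappa> t))\<^sup>2 \<le> 2 * ((K + M1\<^sup>2 + M2\<^sup>2) * (cmod \<beta>)\<^sup>2)"
      proof -
        have "(cmod (sn \<kappa> t))\<^sup>2 \<le> M2\<^sup>2" using M2(2)[OF t] by (intro power_mono) auto
        then have "(cmod (sn \<kappa> t))\<^sup>2 \<le> 2 * (K + M1\<^sup>2 + M2\<^sup>2)"
          using K(1) zero_le_power2[of M1] zero_le_power2[of M2] unfolding distrib_left by linarith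
        from mult_right_mono[OF this zero_le_power2[of "cmod \<beta>"]]
        show ?thesis by (simp only: norm_mult power_mult_distrib mult.assoc mult.commute[of "(cmod \<beta>)\<^sup>2"])
      qed
      finally have "(cmod (esol \<kappa> g \<alpha> \<beta> t))\<^sup>2 \<le> 2 * (2 * ((K + M1\<^sup>2 + M2\<^sup>2) * edge_norm2 l g
         + (K + M1\<^sup>2 + M2\<^sup>2) * (cmod \<alpha>)\<^sup>2) + 2 * ((K + M1\<^sup>2 + M2\<^sup>2) * (cmod \<beta>)\<^sup>2))"
        by simp
      also have "\<dots> = L * (edge_norm2 l g + (cmod \<alpha>)\<^sup>2 + (cmod \<beta>)\<^sup>2)"
        unfolding L_def by (simp only: algebra_simps)
      finally show "(cmod (esol \<kappa> g \<alpha> \<beta> t))\<^sup>2 \<le> L * (edge_norm2 l g + (cmod \<alpha>)\<^sup>2 + (cmod \<beta>)\<^sup>2)" .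
    qed
    then show "edge_norm2 l (esol \<kappa> g \<alpha> \<beta>) \<le> l * L * (edge_norm2 l g + (cmod \<alpha>)\<^sup>2 + (cmod \<beta>)\<^sup>2)"
      by (simp add: mult_ac)
  qed
qed

lemma edge_norm2_cong:
  "(\<And>t. t \<in> {0..l} \<Longrightarrow> u t = v t) \<Longrightarrow> edge_norm2 l u = edge_norm2 l v"
  unfolding edge_norm2_def set_lebesgue_integral_def
  by (rule Bochner_Integration.integral_cong) (auto simp: indicator_def)

text \<open>The value at the endpoint is controlled by the \<open>L\<^sup>2\<close> norm through Green's formula with the
  test function \<open>\<phi> t = t (1 - t/l)\<^sup>2\<close>, for which \<open>\<phi>\<close>, \<open>\<phi>'\<close> vanish at \<open>l\<close> and \<open>\<phi> 0 = 0\<close>, \<open>\<phi>' 0 = 1\<close>.\<close>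

lemma esol_initial_value_bound:
  assumes "\<kappa> \<noteq> 0" "l > 0"
  obtains K where "K > 0" "\<And>\<alpha> \<beta>. (cmod \<alpha>)\<^sup>2 \<le> K * edge_norm2 l (esol \<kappa> (\<lambda>_. 0) \<alpha> \<beta>)"
proof -
  define L where "L = complex_of_real l"
  have Ln: "L \<noteq> 0" using assms by (simp add: L_def)
  define \<phi> where "\<phi> z = z * (1 - z/L)\<^sup>2" for z
  define \<phi>1 where "\<phi>1 z = (1 - z/L)\<^sup>2 - 2 * z / L * (1 - z/L)" for z
  define \<phi>2 where "\<phi>2 z = - 4 / L * (1 - z/L) + 2 * z / L\<^sup>2" for z
  have d1: "((\<lambda>t. \<phi> (of_real t)) has_vector_derivative \<phi>1 (of_real t)) (at t within S)" for t S
    by (rule has_vector_derivative_real_field)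
      (auto simp: \<phi>_def[abs_def] \<phi>1_def Ln field_simps power2_eq_square intro!: derivative_eq_intros)
  have d2: "((\<lambda>t. \<phi>1 (of_real t)) has_vector_derivative \<phi>2 (of_real t)) (at t within S)" for t S
    by (rule has_vector_derivative_real_field)
      (auto simp: \<phi>1_def[abs_def] \<phi>2_def Ln field_simps power2_eq_square intro!: derivative_eq_intros)
  define k where "k t = - (\<phi>2 (of_real t) + \<kappa>\<^sup>2 * \<phi> (of_real t))" for t
  have kc: "continuous_on {0..l} k"
    unfolding k_def[abs_def] \<phi>_def \<phi>2_def using Ln by (intro continuous_intros) auto
  obtain M where M: "M > 0" "\<And>t. t \<in> {0..l} \<Longrightarrow> cmod (k t) \<le> M"
    using continuous_on_bound[OF kc] by blast
  show thesis
  proof (rule that[of "l * M\<^sup>2"])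
    show "l * M\<^sup>2 > 0" using M assms by simp
    fix \<alpha> \<beta>
    let ?u = "esol \<kappa> (\<lambda>_. 0) \<alpha> \<beta>" and ?u' = "esol' \<kappa> (\<lambda>_. 0) \<alpha> \<beta>"
    have s0: "sqint l (\<lambda>_. 0)" by (rule sqint_continuous) auto
    note D = esol_has_vector_derivative[OF assms(1) s0, unfolded prim_zero add_0_right, of _ \<alpha> \<beta>]
    have uc: "continuous_on {0..l} ?u" by (rule continuous_on_esol[OF assms(1) s0])
    have "prim (\<lambda>t. ?u t * k t) l = (?u' l * \<phi> (of_real l) - ?u l * \<phi>1 (of_real l)) - (?u' 0 * \<phi> (of_real 0) - ?u 0 * \<phi>1 (of_real 0))"
    proof (rule prim_derivative[of l "\<lambda>t. ?u' t * \<phi> (of_real t) - ?u t * \<phi>1 (of_real t)"])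
      fix t assume t: "t \<in> {0..l}"
      have "((\<lambda>t. ?u' t * \<phi> (of_real t) - ?u t * \<phi>1 (of_real t)) has_vector_derivative
        (?u' t * \<phi>1 (of_real t) + (- \<kappa>\<^sup>2 * ?u t) * \<phi> (of_real t)) - (?u t * \<phi>2 (of_real t) + ?u' t * \<phi>1 (of_real t))) (at t within {0..l})"
        by (intro has_vector_derivative_diff has_vector_derivative_mult D t d1 d2)
      moreover have "(?u' t * \<phi>1 (of_real t) + (- \<kappa>\<^sup>2 * ?u t) * \<phi> (of_real t)) - (?u t * \<phi>2 (of_real t) + ?u' t * \<phi>1 (of_real t)) = ?u t * k t"
        by (simp add: k_def algebra_simps)
      ultimately show "((\<lambda>t. ?u' t * \<phi> (of_real t) - ?u t * \<phi>1 (of_real t)) has_vector_derivative ?u t * k t) (at t within {0..l})"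
        by simp
    qed (use assms in auto)
    also have "\<dots> = \<alpha>" using Ln by (simp add: \<phi>_def \<phi>1_def L_def)
    finally have al: "\<alpha> = prim (\<lambda>t. ?u t * k t) l" by simp
    have ukc: "continuous_on {0..l} (\<lambda>t. ?u t * k t)" by (intro continuous_intros uc kc)
    have "(cmod \<alpha>)\<^sup>2 \<le> l * edge_norm2 l (\<lambda>t. ?u t * k t)"
      by (subst al, rule prim_bound[OF sqint_continuous[OF ukc]]) (use assms in auto)
    also have "edge_norm2 l (\<lambda>t. ?u t * k t) \<le> M\<^sup>2 * edge_norm2 l ?u"
    proof -
      have "edge_norm2 l (\<lambda>t. ?u t * k t) \<le> (LINT t:{0..l}|lborel. M\<^sup>2 * (cmod (?u t))\<^sup>2)"
        unfolding edge_norm2_def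
      proof (rule set_integral_mono)
        show "set_integrable lborel {0..l} (\<lambda>t. (cmod (?u t * k t))\<^sup>2)"
          by (rule borel_integrable_atLeastAtMost') (intro continuous_intros ukc)
        show "set_integrable lborel {0..l} (\<lambda>t. M\<^sup>2 * (cmod (?u t))\<^sup>2)"
          by (rule borel_integrable_atLeastAtMost') (intro continuous_intros uc)
        fix t assume "t \<in> {0..l}"
        then have "(cmod (k t))\<^sup>2 \<le> M\<^sup>2" using M(2) by (intro power_mono) auto
        from mult_right_mono[OF this zero_le_power2[of "cmod (?u t)"]]
        show "(cmod (?u t * k t))\<^sup>2 \<le> M\<^sup>2 * (cmod (?u t))\<^sup>2"
          by (simp add: norm_mult power_mult_distrib mult.commute)
      qed
      then show ?thesis by (simp add: edge_norm2_def)
    qed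
    finally show "(cmod \<alpha>)\<^sup>2 \<le> l * M\<^sup>2 * edge_norm2 l ?u"
      using assms(2) by (simp add: mult.assoc)
  qed
qed


subsection \<open>Square-summable solutions of the three-term recurrence\<close>

definition ell2 :: "(int \<Rightarrow> complex) \<Rightarrow> bool" where
  "ell2 y \<longleftrightarrow> (\<lambda>j. (cmod (y j))\<^sup>2) summable_on UNIV"

lemma ell2_le:
  assumes "f summable_on UNIV" "\<And>j. (cmod (y j))\<^sup>2 \<le> f j"
  shows "ell2 y"
  unfolding ell2_def by (rule summable_on_comparison_test[OF assms(1)]) (use assms(2) in auto)

lemma ell2_add: "ell2 x \<Longrightarrow> ell2 y \<Longrightarrow> ell2 (\<lambda>j. x j + y j)"
  by (rule ell2_le[of "\<lambda>j. 2 * ((cmod (x j))\<^sup>2 + (cmod (y j))\<^sup>2)"])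
    (auto simp: ell2_def simp del: distrib_left_numeral intro!: summable_on_cmult_right summable_on_add cmod_add_square_le)

lemma ell2_cmult: "ell2 x \<Longrightarrow> ell2 (\<lambda>j. c * x j)"
  unfolding ell2_def norm_mult power_mult_distrib by (rule summable_on_cmult_right)

lemma summable_on_shift:
  fixes f :: "int \<Rightarrow> real"
  assumes "f summable_on UNIV"
  shows "(\<lambda>j. f (j + k)) summable_on UNIV"
  using summable_on_reindex_bij_betw[of "\<lambda>j. j + k" UNIV UNIV f] assms
  by (simp add: bij_plus_right)

lemma ell2_shift: "ell2 x \<Longrightarrow> ell2 (\<lambda>j. x (j + k))"
  unfolding ell2_def by (rule summable_on_shift)

lemma ell2_reflect:
  assumes "ell2 x"
  shows "ell2 (\<lambda>j. x (- j))"
proof -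
  have "bij (uminus :: int \<Rightarrow> int)" by (rule bij_uminus)
  from summable_on_reindex_bij_betw[OF this, of "\<lambda>j. (cmod (x j))\<^sup>2"] show ?thesis
    using assms by (simp add: ell2_def)
qed

lemma summable_on_int_tendsto:
  fixes f :: "int \<Rightarrow> real"
  assumes "f summable_on UNIV" and inj: "inj (\<phi> :: nat \<Rightarrow> int)"
  shows "(\<lambda>n. f (\<phi> n)) \<longlonglongrightarrow> 0"
proof -
  have "f summable_on range \<phi>" by (rule summable_on_subset_banach[OF assms(1)]) simp
  then have "(\<lambda>n. f (\<phi> n)) summable_on UNIV"
    by (subst (asm) summable_on_reindex[OF inj]) (simp add: comp_def)
  then have "summable (\<lambda>n. f (\<phi> n))" by (rule summable_on_imp_summable)
  then show ?thesis by (rule summable_LIMSEQ_zero)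
qed

text \<open>A is the convolution of h with the one-sided kernel z^n. Its square-summability comes
  from the recursion itself: the inequality \<open>step\<close>, summed over a window -N..N, bounds
  the sum S by r * S plus terms independent of N, and r < 1. The shifted window adds at most the
  term at -N-1, which is bounded by \<open>B\<^sup>2\<close>.\<close>

lemma geometric_convolution_ell2:
  assumes z: "cmod z < 1" and h: "ell2 h"
  obtains A where "ell2 A" "\<And>j. A j = z * A (j - 1) + h j"
proof -
  define r where "r = cmod z"
  have r: "0 \<le> r" "r < 1" using z by (auto simp: r_def)
  define H where "H = infsum (\<lambda>j. (cmod (h j))\<^sup>2) UNIV"
  have hs: "(\<lambda>j. (cmod (h j))\<^sup>2) summable_on UNIV" using h by (simp add: ell2_def)
  have fin: "(\<Sum>j\<in>F. (cmod (h j))\<^sup>2) \<le> H" if "finite F" for F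
    unfolding H_def by (rule finite_sum_le_infsum[OF hs that]) auto
  have H0: "H \<ge> 0" unfolding H_def by (rule infsum_nonneg) auto
  have hb: "cmod (h j) \<le> sqrt H" for j
    using fin[of "{j}"] by (simp add: real_le_rsqrt)
  have geo: "summable (\<lambda>n. r ^ n * sqrt H)" using r by (intro summable_mult2 summable_geometric) auto
  have nle: "norm (z ^ n * h (j - int n)) \<le> r ^ n * sqrt H" for n j
    unfolding norm_mult norm_power r_def by (intro mult_left_mono hb) auto
  have sm: "summable (\<lambda>n. z ^ n * h (j - int n))" for j
    by (rule summable_comparison_test'[OF geo nle])
  define A where "A j = (\<Sum>n. z ^ n * h (j - int n))" for j
  have rec: "A j = z * A (j - 1) + h j" for j
  proof -
    have "A j = (\<Sum>n. z ^ Suc n * h (j - int (Suc n))) + h j"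
      using suminf_split_head[OF sm[of j]] by (simp add: A_def)
    also have "(\<Sum>n. z ^ Suc n * h (j - int (Suc n))) = (\<Sum>n. z * (z ^ n * h (j - 1 - int n)))"
      by (simp add: algebra_simps)
    also have "\<dots> = z * A (j - 1)" unfolding A_def by (rule suminf_mult[OF sm])
    finally show ?thesis .
  qed
  define B where "B = (\<Sum>n. r ^ n * sqrt H)"
  have Ab: "(cmod (A j))\<^sup>2 \<le> B\<^sup>2" for j
  proof -
    have "cmod (A j) \<le> B" unfolding A_def B_def by (rule norm_suminf_le[OF nle geo])
    then show ?thesis by (intro power_mono) auto
  qed
  have step: "(cmod (A j))\<^sup>2 \<le> r * (cmod (A (j - 1)))\<^sup>2 + (cmod (h j))\<^sup>2 / (1 - r)" for j
  proof -
    define x where "x = cmod (A (j - 1))"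
    define k where "k = cmod (h j)"
    have "cmod (A j) \<le> r * x + k"
      unfolding rec[of j] x_def k_def r_def norm_mult[symmetric] by (rule norm_triangle_ineq)
    then have "(cmod (A j))\<^sup>2 \<le> (r * x + k)\<^sup>2" by (intro power_mono) auto
    \<comment> \<open>Convexity of the square: r x + k is the average of x and k / (1 - r) with
      weights r and 1 - r.\<close>
    also have "\<dots> \<le> r * x\<^sup>2 + k\<^sup>2 / (1 - r)"
    proof -
      have "(r * x\<^sup>2 + k\<^sup>2 / (1 - r)) - (r * x + k)\<^sup>2 = r / (1 - r) * ((1 - r) * x - k)\<^sup>2"
        using r by (simp add: field_simps power2_eq_square)
      also have "\<dots> \<ge> 0" using r by simp
      finally show ?thesis by simp
    qed
    finally show ?thesis by (simp add: x_def k_def)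
  qed
  have "ell2 A"
    unfolding ell2_def
  proof (rule nonneg_bdd_above_summable_on, force, rule bdd_aboveI)
    fix s assume "s \<in> sum (\<lambda>j. (cmod (A j))\<^sup>2) ` {F. F \<subseteq> UNIV \<and> finite F}"
    then obtain F where F: "finite F" "s = (\<Sum>j\<in>F. (cmod (A j))\<^sup>2)" by auto
    obtain N where N: "F \<subseteq> {-N..N}"
    proof -
      have "F \<subseteq> {Min (insert 0 F)..Max (insert 0 F)}" using F(1) by auto
      then show thesis by (intro that[of "max (- Min (insert 0 F)) (Max (insert 0 F))"]) force
    qed
    define S where "S = (\<Sum>j\<in>{-N..N}. (cmod (A j))\<^sup>2)"
    have "s \<le> S" unfolding F(2) S_def by (rule sum_mono2) (use N in auto)
    have "S \<le> (\<Sum>j\<in>{-N..N}. r * (cmod (A (j - 1)))\<^sup>2 + (cmod (h j))\<^sup>2 / (1 - r))"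
      unfolding S_def by (rule sum_mono) (rule step)
    also have "\<dots> = r * (\<Sum>j\<in>{-N..N}. (cmod (A (j - 1)))\<^sup>2) + (\<Sum>j\<in>{-N..N}. (cmod (h j))\<^sup>2) / (1 - r)"
      by (simp add: sum.distrib sum_distrib_left sum_divide_distrib)
    also have "(\<Sum>j\<in>{-N..N}. (cmod (A (j - 1)))\<^sup>2) \<le> S + B\<^sup>2"
    proof -
      have "(\<Sum>j\<in>{-N..N}. (cmod (A (j - 1)))\<^sup>2) = (\<Sum>j\<in>(\<lambda>j. j - 1) ` {-N..N}. (cmod (A j))\<^sup>2)"
        by (subst sum.reindex) (auto simp: inj_on_def)
      also have "\<dots> \<le> (\<Sum>j\<in>insert (-N-1) {-N..N}. (cmod (A j))\<^sup>2)"
        by (rule sum_mono2) auto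
      also have "\<dots> = (cmod (A (-N-1)))\<^sup>2 + S" by (subst sum.insert) (auto simp: S_def)
      also have "\<dots> \<le> S + B\<^sup>2" using Ab[of "-N-1"] by simp
      finally show ?thesis .
    qed
    also have "(\<Sum>j\<in>{-N..N}. (cmod (h j))\<^sup>2) \<le> H" by (rule fin) simp
    finally have "S \<le> r * (S + B\<^sup>2) + H / (1 - r)" using r by (simp add: mult_left_mono divide_right_mono)
    then have "(1 - r) * S \<le> r * B\<^sup>2 + H / (1 - r)" by (simp add: algebra_simps)
    then have "S \<le> (r * B\<^sup>2 + H / (1 - r)) / (1 - r)" using r by (simp add: pos_le_divide_eq mult.commute)
    with \<open>s \<le> S\<close> show "s \<le> (r * B\<^sup>2 + H / (1 - r)) / (1 - r)" by simp
  qed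
  with rec show thesis using that by blast
qed

lemma ell2_power_abs:
  assumes "cmod z < 1"
  shows "ell2 (\<lambda>j. z ^ nat \<bar>j\<bar>)"
proof -
  define r where "r = (cmod z)\<^sup>2"
  have r: "0 \<le> r" "r < 1" using assms by (auto simp: r_def power_less_one_iff abs_square_less_1)
  have g: "(\<lambda>n. r ^ n) summable_on UNIV"
    using r by (subst summable_on_UNIV_nonneg_real_iff) (auto intro: summable_geometric)
  have 1: "(\<lambda>j. r ^ nat \<bar>j\<bar>) summable_on range int"
    by (subst summable_on_reindex) (use g in \<open>auto simp: comp_def\<close>)
  have 2: "(\<lambda>j. r ^ nat \<bar>j\<bar>) summable_on range (\<lambda>n. - int n)"
    by (subst summable_on_reindex) (use g in \<open>auto simp: comp_def inj_on_def\<close>)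
  have U: "(UNIV :: int set) = range int \<union> range (\<lambda>n. - int n)"
  proof (intro set_eqI iffI)
    fix x :: int
    show "x \<in> range int \<union> range (\<lambda>n. - int n)"
      using image_eqI[of x int "nat x" UNIV] image_eqI[of x "\<lambda>n. - int n" "nat (- x)" UNIV]
      by (cases "x \<ge> 0") auto
  qed auto
  have "(\<lambda>j. r ^ nat \<bar>j\<bar>) summable_on UNIV" unfolding U by (rule summable_on_union[OF 1 2])
  moreover have "(cmod (z ^ nat \<bar>j\<bar>))\<^sup>2 = r ^ nat \<bar>j\<bar>" for j
    by (simp add: r_def norm_power power_mult[symmetric] mult.commute)
  ultimately show ?thesis by (simp add: ell2_def)
qed

text \<open>On either side of 0 the sequence is geometric with ratio z or 1/z, and both are roots of
  the characteristic equation. At 0 both neighbours equal z, so the kink leaves the defect 2 (z -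
  Ft).\<close>

lemma power_abs_recurrence:
  assumes "z \<noteq> (0::complex)" "z + 1/z = 2 * F"
  shows "z ^ nat \<bar>j + 1\<bar> + z ^ nat \<bar>j - 1\<bar> - 2 * (if j = 0 then Ft else F) * z ^ nat \<bar>j\<bar>
    = (if j = 0 then 2 * (z - Ft) else 0)"
proof -
  have *: "z ^ Suc (Suc n) + z ^ n - 2 * F * z ^ Suc n = 0" for n
    unfolding assms(2)[symmetric] using assms(1) by (simp add: field_simps)
  consider "j = 0" | "j > 0" | "j < 0" by linarith
  then show ?thesis
  proof cases
    case 2
    define n where "n = nat (j - 1)"
    have "nat \<bar>j + 1\<bar> = Suc (Suc n)" "nat \<bar>j - 1\<bar> = n" "nat \<bar>j\<bar> = Suc n"
      using 2 by (auto simp: n_def)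
    then show ?thesis using 2 *[of n] by simp
  next
    case 3
    define n where "n = nat (- j - 1)"
    have "nat \<bar>j - 1\<bar> = Suc (Suc n)" "nat \<bar>j + 1\<bar> = n" "nat \<bar>j\<bar> = Suc n"
      using 3 by (auto simp: n_def)
    then show ?thesis using 3 *[of n] by (simp add: algebra_simps)
  qed (simp add: algebra_simps)
qed

text \<open>For Ft = F the defect of z^|j| at 0 is 2 (z - F) = z - 1/z, so the Green's function is
  z^|j-m| / (z - 1/z). The changed coefficient at 0 is a rank-one perturbation, corrected by a
  multiple of z^|j|; this works exactly because that sequence does not solve the perturbed
  equation.\<close>

lemma recurrence_solvable:
  assumes z: "cmod z < 1" "z \<noteq> 0" "z + 1/z = 2 * F" and "Ft \<noteq> z" and h: "ell2 h"
  obtains y where "ell2 y" "\<And>j. y (j + 1) + y (j - 1) - 2 * (if j = 0 then Ft else F) * y j = h j"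
proof -
  obtain A where A: "ell2 A" "\<And>j. A j = z * A (j - 1) + h j"
    using geometric_convolution_ell2[OF z(1) h] by blast
  obtain B' where B': "ell2 B'" "\<And>j. B' j = z * B' (j - 1) + h (- j)"
    using geometric_convolution_ell2[OF z(1) ell2_reflect[OF h]] by blast
  define B where "B j = B' (- j)" for j
  have B: "ell2 B" unfolding B_def by (rule ell2_reflect[OF B'(1)])
  have B2: "B j = z * B (j + 1) + h j" for j
    using B'(2)[of "- j"] by (simp add: B_def)
  have zz: "z - 1/z \<noteq> 0"
  proof
    assume "z - 1/z = 0"
    then have "z * z = 1" using z(2) by (simp add: field_simps)
    then have "cmod z * cmod z = 1" by (metis norm_mult norm_one)
    moreover have "cmod z * cmod z < 1 * 1" using z(1) by (intro mult_strict_mono) auto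
    ultimately show False by simp
  qed
  \<comment> \<open>The two-sided convolution is split into one-sided ones. Both A and B contain the
    diagonal term h j, hence the subtraction.\<close>
  define x where "x j = (A j + B j + (-1) * h j) / (z - 1/z)" for j
  have x: "x (j + 1) + x (j - 1) - 2 * F * x j = h j" for j
  proof -
    let ?U = "\<lambda>j. A j + B j + (-1) * h j"
    have "A (j + 1) = z * A j + h (j + 1)" using A(2)[of "j+1"] by simp
    moreover have "A (j - 1) = (A j - h j) / z" using A(2)[of j] z(2) by (simp add: field_simps)
    moreover have "B (j - 1) = z * B j + h (j - 1)" using B2[of "j-1"] by simp
    moreover have "B (j + 1) = (B j - h j) / z" using B2[of j] z(2) by (simp add: field_simps)
    ultimately have "?U (j + 1) + ?U (j - 1) - (z + 1/z) * ?U j = (z - 1/z) * h j"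
      using z(2) by (simp only:) (simp add: field_simps)
    then have "(?U (j + 1) + ?U (j - 1) - 2 * F * ?U j) / (z - 1/z) = h j"
      using zz unfolding z(3) by (simp add: nonzero_divide_eq_eq mult.commute)
    moreover have "p / d + q / d - f * (r / d) = (p + q - f * r) / d" for p q r f d :: complex
      by (simp add: add_divide_distrib diff_divide_distrib)
    ultimately show ?thesis unfolding x_def by (simp only:)
  qed
  have ex: "ell2 x"
    unfolding x_def divide_inverse
    by (subst mult.commute) (intro ell2_cmult ell2_add A B h)
  \<comment> \<open>Solves 2 (F - Ft) x 0 + 2 c (z - Ft) = 0, the residual of the corrected sequence
    at 0.\<close>
  define c where "c = (Ft - F) * x 0 / (z - Ft)"
  show thesis
  proof (rule that[of "\<lambda>j. x j + c * z ^ nat \<bar>j\<bar>"])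
    show "ell2 (\<lambda>j. x j + c * z ^ nat \<bar>j\<bar>)" by (intro ell2_add ell2_cmult ex ell2_power_abs z)
    fix j
    let ?e = "\<lambda>j. z ^ nat \<bar>j::int\<bar>"
    have "(x (j+1) + c * ?e (j+1)) + (x (j-1) + c * ?e (j-1)) - 2 * (if j = 0 then Ft else F) * (x j + c * ?e j)
      = (x (j+1) + x (j-1) - 2 * F * x j) + 2 * (F - (if j = 0 then Ft else F)) * x j
        + c * (?e (j+1) + ?e (j-1) - 2 * (if j = 0 then Ft else F) * ?e j)"
      by (simp only: algebra_simps)
    also have "\<dots> = h j + 2 * (F - (if j = 0 then Ft else F)) * x j + c * (if j = 0 then 2 * (z - Ft) else 0)"
      unfolding x power_abs_recurrence[OF z(2,3)] by simp
    also have "\<dots> = h j"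
      using assms(4) by (simp add: c_def field_simps)
    finally show "(x (j+1) + c * ?e (j+1)) + (x (j-1) + c * ?e (j-1)) - 2 * (if j = 0 then Ft else F) * (x j + c * ?e j) = h j" .
  qed
qed

text \<open>The combination w n = y (n+1) - z y n removes the mode z^n and keeps only the mode
  z^(-n). Since |z| \<le> 1, |w| cannot decrease, while decay of y drives it to 0; so w vanishes.
  The case |z| = 1 is included for use inside the band.\<close>

lemma half_line_recurrence:
  fixes y :: "nat \<Rightarrow> complex"
  assumes "z \<noteq> 0" "cmod z \<le> 1" "\<And>n. y (Suc (Suc n)) + y n = (z + 1/z) * y (Suc n)" "y \<longlonglongrightarrow> 0"
  shows "y n = z ^ n * y 0"
proof -
  define w where "w n = y (Suc n) - z * y n" for n
  have w: "w n = z * w (Suc n)" for n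
  proof -
    have "z * (y (Suc (Suc n)) + y n) = (z * z + 1) * y (Suc n)"
      unfolding assms(3) using assms(1) by (simp add: field_simps)
    then show ?thesis by (simp add: w_def algebra_simps)
  qed
  have le: "cmod (w n) \<le> cmod (w (n + m))" for n m
  proof (induction m)
    case (Suc m)
    have "cmod (w (n + m)) = cmod z * cmod (w (Suc (n + m)))" by (subst w) (rule norm_mult)
    also have "\<dots> \<le> 1 * cmod (w (Suc (n + m)))" by (intro mult_right_mono assms(2)) auto
    finally show ?case using Suc by simp
  qed simp
  have "w \<longlonglongrightarrow> 0 - z * 0"
    unfolding w_def[abs_def] by (intro tendsto_diff tendsto_mult tendsto_const LIMSEQ_Suc assms(4))
  then have "(\<lambda>n. cmod (w n)) \<longlonglongrightarrow> 0" by (simp add: tendsto_norm_zero)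
  then have "w n = 0" for n
  proof -
    assume t: "(\<lambda>n. cmod (w n)) \<longlonglongrightarrow> 0"
    have "(\<lambda>m. cmod (w (n + m))) \<longlonglongrightarrow> 0" using LIMSEQ_ignore_initial_segment[OF t, of n] by (simp add: add.commute)
    then have "cmod (w n) \<le> 0" by (rule LIMSEQ_le_const) (use le in auto)
    then show ?thesis by simp
  qed
  then have s: "y (Suc n) = z * y n" for n by (simp add: w_def)
  show ?thesis by (induction n) (simp_all add: s)
qed

text \<open>The relation is required only for j other than 0, so the lemma applies both to a changed
  coupling and to a point source at that vertex; the two half-lines are treated separately.\<close>

lemma recurrence_unique:
  fixes y :: "int \<Rightarrow> complex"
  assumes z: "z \<noteq> 0" "cmod z \<le> 1" "z + 1/z = 2 * F"
    and rec: "\<And>j. j \<noteq> 0 \<Longrightarrow> y (j + 1) + y (j - 1) = 2 * F * y j"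
    and lim: "(\<lambda>n. y (int n)) \<longlonglongrightarrow> 0" "(\<lambda>n. y (- int n)) \<longlonglongrightarrow> 0"
  shows "y j = z ^ nat \<bar>j\<bar> * y 0"
proof -
  have 1: "y (int n) = z ^ n * y (int 0)" for n
  proof (rule half_line_recurrence[OF z(1,2) _ lim(1)])
    fix n show "y (int (Suc (Suc n))) + y (int n) = (z + 1/z) * y (int (Suc n))"
      using rec[of "int (Suc n)"] by (simp add: z(3) algebra_simps)
  qed
  have 2: "y (- int n) = z ^ n * y (- int 0)" for n
  proof (rule half_line_recurrence[OF z(1,2) _ lim(2)])
    fix n show "y (- int (Suc (Suc n))) + y (- int n) = (z + 1/z) * y (- int (Suc n))"
      using rec[of "- int (Suc n)"] by (simp add: z(3) algebra_simps)
  qed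
  show ?thesis
  proof (cases "j \<ge> 0")
    case True then show ?thesis using 1[of "nat j"] by simp
  next
    case False then show ?thesis using 2[of "nat (-j)"] by simp
  qed
qed


subsection \<open>Reduction of the graph equation to the recurrence\<close>

locale comb =
  fixes a b \<theta> :: real and \<kappa> :: complex
  assumes a_pos: "a > 0" and b_pos: "b > 0" and \<kappa>_nz: "\<kappa> \<noteq> 0"
    and sin_a: "sin (\<kappa> * of_real a) \<noteq> 0" and sin_b: "sin (\<kappa> * of_real b) \<noteq> 0"
begin

abbreviation "Ca \<equiv> cs \<kappa> a"
abbreviation "Sa \<equiv> sn \<kappa> a"
abbreviation "Cb \<equiv> cs \<kappa> b"
abbreviation "Sb \<equiv> sn \<kappa> b"
abbreviation "C \<equiv> cs \<kappa> (b/2)"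
abbreviation "S \<equiv> sn \<kappa> (b/2)"
abbreviation "\<omega> \<equiv> exp (\<i> * complex_of_real \<theta>)"
abbreviation "\<omega>' \<equiv> exp (- (\<i> * complex_of_real \<theta>))"

text \<open>The vertical edges, closed up by the quasi-periodic condition, act as a loop that adds
  the energy-dependent term 2 (Cb - cos \<theta>) / Sb to the coupling c; with it the formula is the
  Kronig-Penney discriminant.\<close>

definition Fc :: "complex \<Rightarrow> complex" where
  "Fc c = c * Sa / 2 + Ca + Sa * (Cb - of_real (cos \<theta>)) / Sb"

lemma Sa_nz: "Sa \<noteq> 0" and Sb_nz: "Sb \<noteq> 0"
  using sin_a sin_b \<kappa>_nz by (auto simp: sn_def)

lemma omega_inverse: "\<omega> * \<omega>' = 1" "\<omega>' * \<omega> = 1"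
  by (simp_all add: exp_add[symmetric])

lemma omega_sum: "\<omega> + \<omega>' = 2 * of_real (cos \<theta>)"
  by (simp add: cos_of_real[symmetric] cos_exp_eq)

text \<open>P and Q denote end values of \<open>psol\<close> and \<open>psol'\<close>, the letters
  H, U, D the edge, a final p the next edge; ym, y, yp are consecutive vertex values. Here and below
  the expressions are arranged so that \<open>ell2_add\<close> and \<open>ell2_cmult\<close> apply
  summand by summand.\<close>

definition hor_slope :: "complex \<Rightarrow> complex \<Rightarrow> complex \<Rightarrow> complex" where
  "hor_slope ym y PH = (1/Sa) * (y + (-1) * PH + (- Ca) * ym)"

text \<open>Obtained by continuing the upper edge through the quasi-periodic condition into the
  lower one and requiring the value y on return to the vertex; solving for the slope divides by
  Sb.\<close>

definition up_slope :: "complex \<Rightarrow> complex \<Rightarrow> complex \<Rightarrow> complex \<Rightarrow> complex" where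
  "up_slope y PU QU PD = (1/Sb) * ((\<omega> - Cb) * y + (- \<omega>) * PD + (- C) * PU + (- S) * QU)"

definition dn_value :: "complex \<Rightarrow> complex \<Rightarrow> complex \<Rightarrow> complex" where
  "dn_value y \<eta> PU = \<omega>' * (PU + C * y + S * \<eta>)"

definition dn_slope :: "complex \<Rightarrow> complex \<Rightarrow> complex \<Rightarrow> complex" where
  "dn_slope y \<eta> QU = \<omega>' * (QU + (- \<kappa>\<^sup>2 * S) * y + C * \<eta>)"

text \<open>The part of the vertex flux, multiplied by - Sa, that remains when all vertex values are
  0; \<open>up_slope 0\<close> is the source-driven part of the upward slope.\<close>

definition vertex_source :: "complex \<Rightarrow> complex \<Rightarrow> complex \<Rightarrow> complex \<Rightarrow> complex \<Rightarrow> complex \<Rightarrow> complex \<Rightarrow> complex" where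
  "vertex_source PH QH PHp PU QU PD QD =
     Sa * QH + (- Ca) * PH + PHp + (- Sa) * ((1 - \<omega>' * Cb) * up_slope 0 PU QU PD + (- \<omega>' * C) * QU + (\<omega>' * \<kappa>\<^sup>2 * S) * PU + (-1) * QD)"

lemma hor_end: "PH + ym * Ca + hor_slope ym y PH * Sa = y"
  using Sa_nz by (simp add: hor_slope_def)

lemma hor_slope_unique: "PH + ym * Ca + \<beta> * Sa = y \<Longrightarrow> \<beta> = hor_slope ym y PH"
  using Sa_nz by (auto simp: hor_slope_def)

lemma up_end:
  "PU + y * C + \<eta> * S = \<omega> * dn_value y \<eta> PU"
  "QU - \<kappa>\<^sup>2 * y * S + \<eta> * C = \<omega> * dn_slope y \<eta> QU"
  unfolding dn_value_def dn_slope_def mult.assoc[symmetric] omega_inverse by (simp_all add: algebra_simps)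

lemma dn_unique:
  "PU + y * C + \<eta> * S = \<omega> * \<rho> \<Longrightarrow> \<rho> = dn_value y \<eta> PU"
  "QU - \<kappa>\<^sup>2 * y * S + \<eta> * C = \<omega> * \<sigma> \<Longrightarrow> \<sigma> = dn_slope y \<eta> QU"
proof -
  assume "PU + y * C + \<eta> * S = \<omega> * \<rho>"
  then have "dn_value y \<eta> PU = (\<omega>' * \<omega>) * \<rho>" by (simp only: dn_value_def mult.commute mult.left_commute mult.assoc)
  then show "\<rho> = dn_value y \<eta> PU" unfolding omega_inverse by simp
next
  assume "QU - \<kappa>\<^sup>2 * y * S + \<eta> * C = \<omega> * \<sigma>"
  then have "QU + (- \<kappa>\<^sup>2 * S) * y + C * \<eta> = \<omega> * \<sigma>" by (simp add: algebra_simps)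
  then have "dn_slope y \<eta> QU = (\<omega>' * \<omega>) * \<sigma>" by (simp only: dn_slope_def mult.assoc)
  then show "\<sigma> = dn_slope y \<eta> QU" unfolding omega_inverse by simp
qed

text \<open>The double-angle formulas merge the two edges of length b/2 into one of length b, up to
  the phase.\<close>

lemma dn_end_value:
  "dn_value y \<eta> PU * C + dn_slope y \<eta> QU * S = \<omega>' * (PU * C + QU * S + Cb * y + Sb * \<eta>)"
  unfolding dn_value_def dn_slope_def cs_double[OF \<kappa>_nz, of b] sn_double[of \<kappa> b]
  by (simp add: algebra_simps power2_eq_square)

lemma dn_end_slope:
  "- \<kappa>\<^sup>2 * dn_value y \<eta> PU * S + dn_slope y \<eta> QU * C
    = \<omega>' * (- \<kappa>\<^sup>2 * S * PU + C * QU - \<kappa>\<^sup>2 * Sb * y + Cb * \<eta>)"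
  unfolding dn_value_def dn_slope_def cs_double[OF \<kappa>_nz, of b] sn_double[of \<kappa> b]
  by (simp add: algebra_simps power2_eq_square)

lemma dn_end:
  assumes "\<eta> = up_slope y PU QU PD"
  shows "PD + dn_value y \<eta> PU * C + dn_slope y \<eta> QU * S = y"
proof -
  have "Sb * \<eta> = (\<omega> - Cb) * y + (- \<omega>) * PD + (- C) * PU + (- S) * QU"
    using Sb_nz by (simp add: assms up_slope_def)
  then have "PU * C + QU * S + Cb * y + Sb * \<eta> = \<omega> * (y - PD)" by (simp add: algebra_simps)
  then have "dn_value y \<eta> PU * C + dn_slope y \<eta> QU * S = (\<omega>' * \<omega>) * (y - PD)"
    unfolding dn_end_value by (simp add: mult.assoc)
  then show ?thesis unfolding omega_inverse by (simp add: algebra_simps)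
qed

lemma up_slope_unique:
  assumes "PD + dn_value y \<eta> PU * C + dn_slope y \<eta> QU * S = y"
  shows "\<eta> = up_slope y PU QU PD"
proof -
  have "\<omega>' * (PU * C + QU * S + Cb * y + Sb * \<eta>) = y - PD"
    using assms unfolding dn_end_value[symmetric] by (simp add: algebra_simps)
  then have "(\<omega> * \<omega>') * (PU * C + QU * S + Cb * y + Sb * \<eta>) = \<omega> * (y - PD)" by (simp add: mult.assoc)
  then have "Sb * \<eta> = (\<omega> - Cb) * y + (- \<omega>) * PD + (- C) * PU + (- S) * QU"
    unfolding omega_inverse by (simp add: algebra_simps)
  then show ?thesis using Sb_nz by (simp add: up_slope_def field_simps)
qed

text \<open>Multiplication by Sa clears the denominators of the horizontal slopes. The coefficient
  of ym then becomes Ca^2 + \<kappa>^2 Sa^2 = 1, and what multiplies y is collected in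
  \<open>Fc\<close>.\<close>

lemma flux_identity:
  assumes "\<eta> = up_slope y PU QU PD"
  shows "Sa * (- (QH - \<kappa>\<^sup>2 * ym * Sa + hor_slope ym y PH * Ca) + hor_slope y yp PHp + \<eta>
      - (QD - \<kappa>\<^sup>2 * dn_value y \<eta> PU * S + dn_slope y \<eta> QU * C) - c * y)
    = yp + ym - 2 * Fc c * y - vertex_source PH QH PHp PU QU PD QD"
proof -
  define \<eta>0 where "\<eta>0 = up_slope 0 PU QU PD"
  have eta: "\<eta> = (\<omega> - Cb) / Sb * y + \<eta>0"
    unfolding assms \<eta>0_def up_slope_def using Sb_nz by (simp add: field_simps)
  have h1: "Sa * hor_slope ym y PH = y - PH - Ca * ym" and h2: "Sa * hor_slope y yp PHp = yp - PHp - Ca * y"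
    using Sa_nz by (simp_all add: hor_slope_def)
  \<comment> \<open>The response of the vertical loop to y. The phases combine to \<omega> +
    \<omega>' = 2 cos \<theta>, so \<theta> enters the recurrence coefficient only through its
    cosine.\<close>
  have key: "(\<omega> - Cb) / Sb * (1 - \<omega>' * Cb) + \<omega>' * \<kappa>\<^sup>2 * Sb = 2 * (of_real (cos \<theta>) - Cb) / Sb"
  proof -
    have "(\<omega> - Cb) * (1 - \<omega>' * Cb) + \<omega>' * (\<kappa>\<^sup>2 * Sb\<^sup>2) = (\<omega> + \<omega>' * (Cb\<^sup>2 + \<kappa>\<^sup>2 * Sb\<^sup>2)) - Cb - (\<omega> * \<omega>') * Cb"
      by (simp only: power2_eq_square algebra_simps mult_1_left)
    also have "\<dots> = 2 * (of_real (cos \<theta>) - Cb)"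
      unfolding cs_sn_square[OF \<kappa>_nz] omega_inverse mult_1_right omega_sum by simp
    finally have "((\<omega> - Cb) * (1 - \<omega>' * Cb) + \<omega>' * (\<kappa>\<^sup>2 * Sb\<^sup>2)) / Sb = 2 * (of_real (cos \<theta>) - Cb) / Sb"
      by simp
    then show ?thesis using Sb_nz by (simp add: add_divide_distrib power2_eq_square mult.assoc)
  qed
  have "- (QD - \<kappa>\<^sup>2 * dn_value y \<eta> PU * S + dn_slope y \<eta> QU * C)
      = - QD - \<omega>' * (- \<kappa>\<^sup>2 * S * PU + C * QU - \<kappa>\<^sup>2 * Sb * y + Cb * \<eta>)"
    unfolding dn_end_slope[symmetric] by simp
  then have "\<eta> - (QD - \<kappa>\<^sup>2 * dn_value y \<eta> PU * S + dn_slope y \<eta> QU * C)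
      = \<eta> * (1 - \<omega>' * Cb) + \<omega>' * \<kappa>\<^sup>2 * Sb * y - QD - \<omega>' * (- \<kappa>\<^sup>2 * S * PU + C * QU)"
    by (simp add: algebra_simps)
  also have "\<dots> = ((\<omega> - Cb) / Sb * (1 - \<omega>' * Cb) + \<omega>' * \<kappa>\<^sup>2 * Sb) * y
      + (1 - \<omega>' * Cb) * \<eta>0 - QD - \<omega>' * (- \<kappa>\<^sup>2 * S * PU + C * QU)"
    unfolding eta by (simp only: algebra_simps)
  also have "\<dots> = 2 * (of_real (cos \<theta>) - Cb) / Sb * y
      + (1 - \<omega>' * Cb) * \<eta>0 - QD - \<omega>' * (- \<kappa>\<^sup>2 * S * PU + C * QU)"
    unfolding key by (rule refl)
  finally have v: "\<eta> - (QD - \<kappa>\<^sup>2 * dn_value y \<eta> PU * S + dn_slope y \<eta> QU * C)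
     = 2 * (of_real (cos \<theta>) - Cb) / Sb * y
      + (1 - \<omega>' * Cb) * \<eta>0 - QD - \<omega>' * (- \<kappa>\<^sup>2 * S * PU + C * QU)" .
  have "Sa * (- (QH - \<kappa>\<^sup>2 * ym * Sa + hor_slope ym y PH * Ca) + hor_slope y yp PHp + \<eta>
      - (QD - \<kappa>\<^sup>2 * dn_value y \<eta> PU * S + dn_slope y \<eta> QU * C) - c * y)
    = - Sa * QH + \<kappa>\<^sup>2 * Sa\<^sup>2 * ym - Ca * (Sa * hor_slope ym y PH) + Sa * hor_slope y yp PHp
      + Sa * (\<eta> - (QD - \<kappa>\<^sup>2 * dn_value y \<eta> PU * S + dn_slope y \<eta> QU * C)) - c * Sa * y"
    by (simp add: algebra_simps power2_eq_square)
  also have "\<dots> = - Sa * QH + \<kappa>\<^sup>2 * Sa\<^sup>2 * ym - Ca * (y - PH - Ca * ym) + (yp - PHp - Ca * y)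
      + Sa * (2 * (of_real (cos \<theta>) - Cb) / Sb * y
      + (1 - \<omega>' * Cb) * \<eta>0 - QD - \<omega>' * (- \<kappa>\<^sup>2 * S * PU + C * QU)) - c * Sa * y"
    unfolding h1 h2 v by (rule refl)
  also have "\<dots> = (Ca\<^sup>2 + \<kappa>\<^sup>2 * Sa\<^sup>2) * ym + yp - 2 * Fc c * y - vertex_source PH QH PHp PU QU PD QD"
    unfolding Fc_def vertex_source_def \<eta>0_def[symmetric]
    by (simp add: algebra_simps power2_eq_square diff_divide_distrib)
  finally show ?thesis unfolding cs_sn_square[OF \<kappa>_nz] by simp
qed


section \<open>Assembling a function on the graph from its vertex values\<close>

fun graph_sol :: "(int \<Rightarrow> etype \<Rightarrow> real \<Rightarrow> complex) \<Rightarrow> (int \<Rightarrow> complex) \<Rightarrow> int \<Rightarrow> etype \<Rightarrow> real \<Rightarrow> complex" where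
  "graph_sol g y j Hor = esol \<kappa> (g j Hor) (y (j - 1)) (hor_slope (y (j - 1)) (y j) (psol \<kappa> (g j Hor) a))"
| "graph_sol g y j Up = esol \<kappa> (g j Up) (y j)
     (up_slope (y j) (psol \<kappa> (g j Up) (b/2)) (psol' \<kappa> (g j Up) (b/2)) (psol \<kappa> (g j Dn) (b/2)))"
| "graph_sol g y j Dn =
     (let \<eta> = up_slope (y j) (psol \<kappa> (g j Up) (b/2)) (psol' \<kappa> (g j Up) (b/2)) (psol \<kappa> (g j Dn) (b/2))
      in esol \<kappa> (g j Dn) (dn_value (y j) \<eta> (psol \<kappa> (g j Up) (b/2))) (dn_slope (y j) \<eta> (psol' \<kappa> (g j Up) (b/2))))"

definition graph_source :: "(int \<Rightarrow> etype \<Rightarrow> real \<Rightarrow> complex) \<Rightarrow> int \<Rightarrow> complex" where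
  "graph_source g j = vertex_source (psol \<kappa> (g j Hor) a) (psol' \<kappa> (g j Hor) a) (psol \<kappa> (g (j + 1) Hor) a)
     (psol \<kappa> (g j Up) (b/2)) (psol' \<kappa> (g j Up) (b/2)) (psol \<kappa> (g j Dn) (b/2)) (psol' \<kappa> (g j Dn) (b/2))"

lemma graph_source_zero [simp]: "graph_source (\<lambda>_ _ _. 0) j = 0"
  by (simp add: graph_source_def vertex_source_def up_slope_def)

lemma elen_pos: "elen a b e > 0"
  using a_pos b_pos by (cases e) (auto simp: elen_def)

lemma L2g_edge:
  assumes "L2g a b g"
  shows "sqint (elen a b e) (g j e)" "(\<lambda>j. edge_norm2 (elen a b e) (g j e)) summable_on UNIV"
proof -
  show "sqint (elen a b e) (g j e)" using assms unfolding L2g_def by blast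
  have s: "(\<lambda>j. edge_norm2 a (g j Hor) + edge_norm2 (b/2) (g j Up) + edge_norm2 (b/2) (g j Dn)) summable_on UNIV"
    using assms unfolding L2g_def by blast
  show "(\<lambda>j. edge_norm2 (elen a b e) (g j e)) summable_on UNIV"
    by (rule summable_on_comparison_test[OF s]) (cases e; simp add: elen_def edge_norm2_nonneg)+
qed

lemma L2gI:
  assumes "\<And>j e. sqint (elen a b e) (g j e)" "\<And>e. (\<lambda>j. edge_norm2 (elen a b e) (g j e)) summable_on UNIV"
  shows "L2g a b g"
  unfolding L2g_def
proof (intro conjI allI assms(1))
  show "(\<lambda>j. edge_norm2 a (g j Hor) + edge_norm2 (b/2) (g j Up) + edge_norm2 (b/2) (g j Dn)) summable_on UNIV"
    using assms(2)[of Hor] assms(2)[of Up] assms(2)[of Dn]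
    by (intro summable_on_add) (simp_all add: elen_def)
qed

lemma ell2_psol:
  assumes "L2g a b g"
  shows "ell2 (\<lambda>j. psol \<kappa> (g j e) (elen a b e))" "ell2 (\<lambda>j. psol' \<kappa> (g j e) (elen a b e))"
proof -
  have t: "elen a b e \<in> {0..elen a b e}" using elen_pos[of e] by simp
  obtain K where K: "\<And>g t. sqint (elen a b e) g \<Longrightarrow> t \<in> {0..elen a b e} \<Longrightarrow> (cmod (psol \<kappa> g t))\<^sup>2 \<le> K * edge_norm2 (elen a b e) g"
    "\<And>g t. sqint (elen a b e) g \<Longrightarrow> t \<in> {0..elen a b e} \<Longrightarrow> (cmod (psol' \<kappa> g t))\<^sup>2 \<le> K * edge_norm2 (elen a b e) g"
    using psol_bound[OF \<kappa>_nz elen_pos[of e]] by metis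
  have s: "(\<lambda>j. K * edge_norm2 (elen a b e) (g j e)) summable_on UNIV"
    by (intro summable_on_cmult_right L2g_edge(2)[OF assms])
  show "ell2 (\<lambda>j. psol \<kappa> (g j e) (elen a b e))"
    by (rule ell2_le[OF s]) (rule K(1)[OF L2g_edge(1)[OF assms] t])
  show "ell2 (\<lambda>j. psol' \<kappa> (g j e) (elen a b e))"
    by (rule ell2_le[OF s]) (rule K(2)[OF L2g_edge(1)[OF assms] t])
qed

lemma ell2_graph_source:
  assumes "L2g a b g"
  shows "ell2 (graph_source g)"
  unfolding graph_source_def[abs_def] vertex_source_def up_slope_def
  using ell2_psol[OF assms, of Hor] ell2_psol[OF assms, of Up] ell2_psol[OF assms, of Dn]
    ell2_shift[OF ell2_psol(1)[OF assms, of Hor], of 1]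
  by (intro ell2_add ell2_cmult) (simp_all add: elen_def ell2_def)

lemma summable_esol_norm:
  assumes "L2g a b g" "ell2 \<alpha>" "ell2 \<beta>"
  shows "(\<lambda>j. edge_norm2 (elen a b e) (esol \<kappa> (g j e) (\<alpha> j) (\<beta> j))) summable_on UNIV"
proof -
  obtain K where K: "\<And>g \<alpha> \<beta>. sqint (elen a b e) g \<Longrightarrow>
    edge_norm2 (elen a b e) (esol \<kappa> g \<alpha> \<beta>) \<le> K * (edge_norm2 (elen a b e) g + (cmod \<alpha>)\<^sup>2 + (cmod \<beta>)\<^sup>2)"
    using esol_norm_bound[OF \<kappa>_nz elen_pos[of e]] by metis
  have s: "(\<lambda>j. K * (edge_norm2 (elen a b e) (g j e) + (cmod (\<alpha> j))\<^sup>2 + (cmod (\<beta> j))\<^sup>2)) summable_on UNIV"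
    using assms(2,3) unfolding ell2_def
    by (intro summable_on_cmult_right summable_on_add L2g_edge(2)[OF assms(1)])
  show ?thesis
    by (rule summable_on_comparison_test[OF s]) (rule K[OF L2g_edge(1)[OF assms(1)]], rule edge_norm2_nonneg)
qed

lemma graph_sol_esol: "\<exists>\<alpha> \<beta>. graph_sol g y j e = esol \<kappa> (g j e) \<alpha> \<beta>"
  by (cases e) (auto simp: Let_def)

lemma L2g_graph_sol:
  assumes g: "L2g a b g" and y: "ell2 y"
  shows "L2g a b (graph_sol g y)"
proof (rule L2gI)
  fix j e
  obtain \<alpha> \<beta> where "graph_sol g y j e = esol \<kappa> (g j e) \<alpha> \<beta>" using graph_sol_esol by blast
  then show "sqint (elen a b e) (graph_sol g y j e)"
    using sqint_continuous[OF continuous_on_esol[OF \<kappa>_nz L2g_edge(1)[OF g]]] by simp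
next
  fix e
  note P = ell2_psol[OF g, of Hor, unfolded elen_def etype.case]
    ell2_psol[OF g, of Up, unfolded elen_def etype.case]
    ell2_psol[OF g, of Dn, unfolded elen_def etype.case]
  have y1: "ell2 (\<lambda>j. y (j - 1))" using ell2_shift[OF y, of "-1"] by simp
  have H: "ell2 (\<lambda>j. hor_slope (y (j - 1)) (y j) (psol \<kappa> (g j Hor) a))"
    unfolding hor_slope_def by (intro ell2_add ell2_cmult P y y1)
  define \<eta> where "\<eta> j = up_slope (y j) (psol \<kappa> (g j Up) (b/2)) (psol' \<kappa> (g j Up) (b/2)) (psol \<kappa> (g j Dn) (b/2))" for j
  have U: "ell2 \<eta>"
    unfolding \<eta>_def up_slope_def by (intro ell2_add ell2_cmult P y)
  have D1: "ell2 (\<lambda>j. dn_value (y j) (\<eta> j) (psol \<kappa> (g j Up) (b/2)))"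
    unfolding dn_value_def by (intro ell2_add ell2_cmult P y U)
  have D2: "ell2 (\<lambda>j. dn_slope (y j) (\<eta> j) (psol' \<kappa> (g j Up) (b/2)))"
    unfolding dn_slope_def by (intro ell2_add ell2_cmult P y U)
  show "(\<lambda>j. edge_norm2 (elen a b e) (graph_sol g y j e)) summable_on UNIV"
  proof (cases e)
    case Hor
    show ?thesis unfolding Hor graph_sol.simps by (rule summable_esol_norm[OF g y1 H])
  next
    case Up
    show ?thesis unfolding Up graph_sol.simps \<eta>_def[symmetric] by (rule summable_esol_norm[OF g y U])
  next
    case Dn
    show ?thesis unfolding Dn graph_sol.simps \<eta>_def[symmetric] Let_def by (rule summable_esol_norm[OF g D1 D2])
  qed
qed

lemma solves_graph_sol:
  assumes g: "L2g a b g" and y: "ell2 y"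
    and rec: "\<And>j. y (j + 1) + y (j - 1) - 2 * Fc (of_real (c j)) * y j = graph_source g j"
  shows "solves a b c \<theta> (\<kappa>\<^sup>2) (graph_sol g y) g"
  unfolding solves_def
proof (intro conjI allI)
  show "L2g a b (graph_sol g y)" by (rule L2g_graph_sol[OF g y])
  fix j e
  obtain \<alpha> \<beta> where "graph_sol g y j e = esol \<kappa> (g j e) \<alpha> \<beta>" using graph_sol_esol by blast
  then show "H2sol (elen a b e) (graph_sol g y j e) (\<lambda>t. - (g j e t + \<kappa>\<^sup>2 * graph_sol g y j e t))"
    using H2sol_esol[OF \<kappa>_nz L2g_edge(1)[OF g]] by simp
next
  show "vertex_conds a b c \<theta> (graph_sol g y)"
    unfolding vertex_conds_def
  proof (intro allI)
    fix j
    define PU QU PD QD where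
      "PU = psol \<kappa> (g j Up) (b/2)" and "QU = psol' \<kappa> (g j Up) (b/2)"
      and "PD = psol \<kappa> (g j Dn) (b/2)" and "QD = psol' \<kappa> (g j Dn) (b/2)"
    define PH QH PHp where "PH = psol \<kappa> (g j Hor) a" and "QH = psol' \<kappa> (g j Hor) a"
      and "PHp = psol \<kappa> (g (j + 1) Hor) a"
    define \<eta> where "\<eta> = up_slope (y j) PU QU PD"
    let ?\<psi> = "graph_sol g y"
    note defs = PU_def[symmetric] QU_def[symmetric] PD_def[symmetric] QD_def[symmetric]
      PH_def[symmetric] QH_def[symmetric] PHp_def[symmetric] \<eta>_def[symmetric]
    have H: "?\<psi> j Hor = esol \<kappa> (g j Hor) (y (j - 1)) (hor_slope (y (j - 1)) (y j) PH)"
      by (simp add: defs)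
    have Hp: "?\<psi> (j+1) Hor = esol \<kappa> (g (j+1) Hor) (y j) (hor_slope (y j) (y (j+1)) PHp)"
      by (simp add: defs)
    have U: "?\<psi> j Up = esol \<kappa> (g j Up) (y j) \<eta>" by (simp add: defs)
    have D: "?\<psi> j Dn = esol \<kappa> (g j Dn) (dn_value (y j) \<eta> PU) (dn_slope (y j) \<eta> QU)"
      by (simp add: defs Let_def)
    note sq = L2g_edge(1)[OF g, of Hor, unfolded elen_def etype.case]
      L2g_edge(1)[OF g, of Up, unfolded elen_def etype.case]
      L2g_edge(1)[OF g, of Dn, unfolded elen_def etype.case]
    have tt: "a \<in> {0..a}" "0 \<in> {0..a}" "b/2 \<in> {0..b/2}" "0 \<in> {0..b/2}" "b/2 > 0"
      using a_pos b_pos by auto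
    have d1: "dv a (?\<psi> j Hor) a = QH - \<kappa>\<^sup>2 * y (j - 1) * Sa + hor_slope (y (j - 1)) (y j) PH * Ca"
      unfolding H dv_esol[OF \<kappa>_nz sq(1) tt(1) a_pos] esol'_def defs by (rule refl)
    have d2: "dv a (?\<psi> (j+1) Hor) 0 = hor_slope (y j) (y (j+1)) PHp"
      unfolding Hp dv_esol[OF \<kappa>_nz sq(1) tt(2) a_pos] by simp
    have d3: "dv (b/2) (?\<psi> j Up) 0 = \<eta>"
      unfolding U dv_esol[OF \<kappa>_nz sq(2) tt(4) tt(5)] by simp
    have d4: "dv (b/2) (?\<psi> j Dn) (b/2) = QD - \<kappa>\<^sup>2 * dn_value (y j) \<eta> PU * S + dn_slope (y j) \<eta> QU * C"
      unfolding D dv_esol[OF \<kappa>_nz sq(3) tt(3) tt(5)] esol'_def defs by (rule refl)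
    have d5: "dv (b/2) (?\<psi> j Up) (b/2) = QU - \<kappa>\<^sup>2 * y j * S + \<eta> * C"
      unfolding U dv_esol[OF \<kappa>_nz sq(2) tt(3) tt(5)] esol'_def defs by (rule refl)
    have d6: "dv (b/2) (?\<psi> j Dn) 0 = dn_slope (y j) \<eta> QU"
      unfolding D dv_esol[OF \<kappa>_nz sq(3) tt(4) tt(5)] by simp
    have e1: "?\<psi> j Hor a = y j"
      unfolding H esol_def defs using hor_end by simp
    have e2: "?\<psi> (j+1) Hor 0 = y j" "?\<psi> j Up 0 = y j" unfolding Hp U by simp_all
    have e3: "?\<psi> j Dn (b/2) = y j"
      unfolding D esol_def defs by (rule dn_end[OF \<eta>_def])
    have e4: "?\<psi> j Up (b/2) = \<omega> * ?\<psi> j Dn 0"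
      unfolding D U esol_0 unfolding esol_def defs by (rule up_end(1))
    have e5: "dv (b/2) (?\<psi> j Up) (b/2) = \<omega> * dv (b/2) (?\<psi> j Dn) 0"
      unfolding d5 d6 by (rule up_end(2))
    \<comment> \<open>The recurrence is Sa times the derivative condition at the vertex; cancelling
      Sa recovers the condition.\<close>
    have "Sa * (- dv a (?\<psi> j Hor) a + dv a (?\<psi> (j+1) Hor) 0 + dv (b/2) (?\<psi> j Up) 0 - dv (b/2) (?\<psi> j Dn) (b/2)
        - of_real (c j) * y j) = 0"
      unfolding d1 d2 d3 d4 flux_identity[OF \<eta>_def] rec graph_source_def defs by simp
    then have "- dv a (?\<psi> j Hor) a + dv a (?\<psi> (j+1) Hor) 0 + dv (b/2) (?\<psi> j Up) 0 - dv (b/2) (?\<psi> j Dn) (b/2)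
        = complex_of_real (c j) * ?\<psi> j Up 0"
      using Sa_nz unfolding e2 by simp
    then show "?\<psi> j Hor a = ?\<psi> (j+1) Hor 0 \<and> ?\<psi> (j+1) Hor 0 = ?\<psi> j Up 0 \<and> ?\<psi> j Up 0 = ?\<psi> j Dn (b/2) \<and>
      - dv a (?\<psi> j Hor) a + dv a (?\<psi> (j+1) Hor) 0 + dv (b/2) (?\<psi> j Up) 0 - dv (b/2) (?\<psi> j Dn) (b/2)
        = complex_of_real (c j) * ?\<psi> j Up 0 \<and>
      ?\<psi> j Up (b/2) = \<omega> * ?\<psi> j Dn 0 \<and>
      dv (b/2) (?\<psi> j Up) (b/2) = \<omega> * dv (b/2) (?\<psi> j Dn) 0"
      using e1 e2 e3 e4 e5 by presburger
  qed
qed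

text \<open>Converse of the assembly: unique slopes on the edges leave only the vertex values free.
  The extra flux s lets the same computation serve eigenfunctions (s = 0) and the unit flux used
  inside the band.\<close>

lemma homogeneous_eq_graph_sol:
  assumes H: "\<And>j e. H2sol (elen a b e) (\<psi> j e) (\<lambda>t. - (\<kappa>\<^sup>2 * \<psi> j e t))"
    and cont: "\<And>j. \<psi> j Hor a = \<psi> j Up 0" "\<And>j. \<psi> (j+1) Hor 0 = \<psi> j Up 0" "\<And>j. \<psi> j Dn (b/2) = \<psi> j Up 0"
    and flux: "\<And>j. - dv a (\<psi> j Hor) a + dv a (\<psi> (j+1) Hor) 0 + dv (b/2) (\<psi> j Up) 0 - dv (b/2) (\<psi> j Dn) (b/2)
        = complex_of_real (c j) * \<psi> j Up 0 + s j"
    and quasi: "\<And>j. \<psi> j Up (b/2) = \<omega> * \<psi> j Dn 0" "\<And>j. dv (b/2) (\<psi> j Up) (b/2) = \<omega> * dv (b/2) (\<psi> j Dn) 0"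
  defines "y \<equiv> \<lambda>j. \<psi> j Up 0"
  shows "t \<in> {0..elen a b e} \<Longrightarrow> \<psi> j e t = graph_sol (\<lambda>_ _ _. 0) y j e t"
    and "y (j + 1) + y (j - 1) - 2 * Fc (of_real (c j)) * y j = Sa * s j"
proof -
  have tt: "a \<in> {0..a}" "0 \<in> {0..a}" "b/2 \<in> {0..b/2}" "0 \<in> {0..b/2}" "b/2 > 0"
      using a_pos b_pos by auto
  define \<beta> where "\<beta> j = dv a (\<psi> j Hor) 0" for j
  define \<eta> where "\<eta> j = dv (b/2) (\<psi> j Up) 0" for j
  \<comment> \<open>Edge \<open>(Hor, j)\<close> starts at the vertex with index j - 1.\<close>
  have h0: "\<psi> j Hor 0 = y (j - 1)" for j using cont(2)[of "j - 1"] by (simp add: y_def)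
  have hH: "\<psi> j Hor t = esol \<kappa> (\<lambda>_. 0) (y (j - 1)) (\<beta> j) t"
    "dv a (\<psi> j Hor) t = esol' \<kappa> (\<lambda>_. 0) (y (j - 1)) (\<beta> j) t" if "t \<in> {0..a}" for j t
    using H2sol_homogeneous_eq[OF \<kappa>_nz a_pos H[of Hor, unfolded elen_def etype.case] that]
    unfolding h0 \<beta>_def by auto
  have hU: "\<psi> j Up t = esol \<kappa> (\<lambda>_. 0) (y j) (\<eta> j) t"
    "dv (b/2) (\<psi> j Up) t = esol' \<kappa> (\<lambda>_. 0) (y j) (\<eta> j) t" if "t \<in> {0..b/2}" for j t
    using H2sol_homogeneous_eq[OF \<kappa>_nz tt(5) H[of Up, unfolded elen_def etype.case] that]
    unfolding \<eta>_def y_def by auto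
  have hD: "\<psi> j Dn t = esol \<kappa> (\<lambda>_. 0) (\<psi> j Dn 0) (dv (b/2) (\<psi> j Dn) 0) t"
    "dv (b/2) (\<psi> j Dn) t = esol' \<kappa> (\<lambda>_. 0) (\<psi> j Dn 0) (dv (b/2) (\<psi> j Dn) 0) t" if "t \<in> {0..b/2}" for j t
    using H2sol_homogeneous_eq[OF \<kappa>_nz tt(5) H[of Dn, unfolded elen_def etype.case] that] by auto
  have be: "\<beta> j = hor_slope (y (j - 1)) (y j) 0" for j
    by (rule hor_slope_unique) (use hH(1)[OF tt(1), of j] cont(1)[of j] in \<open>simp add: esol_def y_def\<close>)
  have r: "\<psi> j Dn 0 = dn_value (y j) (\<eta> j) 0" for j
    by (rule dn_unique(1)) (use hU(1)[OF tt(3), of j] quasi(1)[of j] in \<open>simp add: esol_def\<close>)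
  have s: "dv (b/2) (\<psi> j Dn) 0 = dn_slope (y j) (\<eta> j) 0" for j
    by (rule dn_unique(2)) (use hU(2)[OF tt(3), of j] quasi(2)[of j] in \<open>simp add: esol'_def\<close>)
  have et: "\<eta> j = up_slope (y j) 0 0 0" for j
  proof (rule up_slope_unique)
    show "0 + dn_value (y j) (\<eta> j) 0 * C + dn_slope (y j) (\<eta> j) 0 * S = y j"
      using hD(1)[OF tt(3), of j] unfolding cont(3) r s by (simp add: esol_def y_def)
  qed
  show "\<psi> j e t = graph_sol (\<lambda>_ _ _. 0) y j e t" if t: "t \<in> {0..elen a b e}"
  proof (cases e)
    case Hor then show ?thesis using hH(1)[of t j] t by (simp add: be elen_def)
  next
    case Up then show ?thesis using hU(1)[of t j] t by (simp add: et elen_def)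
  next
    case Dn then show ?thesis using hD(1)[of t j] t by (simp add: r s et[symmetric] elen_def Let_def)
  qed
  have "Sa * (- (0 - \<kappa>\<^sup>2 * y (j-1) * Sa + hor_slope (y (j-1)) (y j) 0 * Ca) + hor_slope (y j) (y (j+1)) 0 + \<eta> j
      - (0 - \<kappa>\<^sup>2 * dn_value (y j) (\<eta> j) 0 * S + dn_slope (y j) (\<eta> j) 0 * C) - of_real (c j) * y j)
    = y (j+1) + y (j-1) - 2 * Fc (of_real (c j)) * y j - vertex_source 0 0 0 0 0 0 0"
    by (rule flux_identity[OF et])
  moreover have "- (0 - \<kappa>\<^sup>2 * y (j-1) * Sa + hor_slope (y (j-1)) (y j) 0 * Ca) + hor_slope (y j) (y (j+1)) 0 + \<eta> j
      - (0 - \<kappa>\<^sup>2 * dn_value (y j) (\<eta> j) 0 * S + dn_slope (y j) (\<eta> j) 0 * C) = of_real (c j) * y j + s j"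
    using flux[of j] hH(2)[OF tt(1), of j] hH(2)[OF tt(2), of "j+1"] hU(2)[OF tt(4), of j] hD(2)[OF tt(3), of j]
    unfolding r s by (simp add: esol'_def be y_def)
  ultimately show "y (j + 1) + y (j - 1) - 2 * Fc (of_real (c j)) * y j = Sa * s j"
    by (simp add: vertex_source_def up_slope_def)
qed

end


section \<open>Resolvent points, eigenspaces and the band\<close>

context comb
begin

text \<open>The vertex value is the initial value of the upper edge, hence bounded by the L^2 norm
  there, with one constant for all j. An arbitrary injection covers both ends of the comb.\<close>

lemma vertex_values_tendsto_0:
  assumes L2: "L2g a b \<psi>"
    and eq: "\<And>j t. t \<in> {0..b/2} \<Longrightarrow> \<psi> j Up t = graph_sol (\<lambda>_ _ _. 0) y j Up t"
    and inj: "inj (\<phi> :: nat \<Rightarrow> int)"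
  shows "(\<lambda>n. y (\<phi> n)) \<longlonglongrightarrow> 0"
proof -
  have b2: "b/2 > 0" using b_pos by simp
  obtain K where K: "\<And>\<alpha> \<beta>. (cmod \<alpha>)\<^sup>2 \<le> K * edge_norm2 (b/2) (esol \<kappa> (\<lambda>_. 0) \<alpha> \<beta>)"
    using esol_initial_value_bound[OF \<kappa>_nz b2] by metis
  have le: "(cmod (y j))\<^sup>2 \<le> K * edge_norm2 (b/2) (\<psi> j Up)" for j
  proof -
    have "edge_norm2 (b/2) (\<psi> j Up) = edge_norm2 (b/2) (graph_sol (\<lambda>_ _ _. 0) y j Up)"
      by (rule edge_norm2_cong) (rule eq)
    then show ?thesis using K[of "y j"] by simp
  qed
  have "(\<lambda>j. K * edge_norm2 (b/2) (\<psi> j Up)) summable_on UNIV"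
    using L2g_edge(2)[OF L2, of Up] by (intro summable_on_cmult_right) (simp add: elen_def)
  from ell2_le[OF this le] have "(\<lambda>n. (cmod (y (\<phi> n)))\<^sup>2) \<longlonglongrightarrow> 0"
    unfolding ell2_def by (rule summable_on_int_tendsto[OF _ inj])
  from tendsto_real_sqrt[OF this] have "(\<lambda>n. cmod (y (\<phi> n))) \<longlonglongrightarrow> 0" by simp
  then show ?thesis by (rule tendsto_norm_zero_cancel)
qed

lemma inj_int_minus: "inj (\<lambda>n. - int n)"
  by (simp add: inj_on_def)

text \<open>Decay selects the mode z^|j| on both sides, which leaves y 0 as the only free parameter;
  the equation at vertex 0 then either kills it or forces the eigenvalue condition.\<close>

lemma homogeneous_solution:
  assumes sol: "solves a b (coup \<gamma> \<gamma>t) \<theta> (\<kappa>\<^sup>2) \<psi> (\<lambda>_ _ _. 0)"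
    and z: "z \<noteq> 0" "cmod z < 1" "z + 1/z = 2 * Fc (of_real \<gamma>)"
  defines "y \<equiv> \<lambda>j. \<psi> j Up 0"
  shows "\<And>j. y j = z ^ nat \<bar>j\<bar> * y 0"
    and "\<And>t. t \<in> {0..elen a b e} \<Longrightarrow> \<psi> j e t = graph_sol (\<lambda>_ _ _. 0) y j e t"
    and "(z - Fc (of_real \<gamma>t)) * y 0 = 0"
proof -
  have L2: "L2g a b \<psi>" and H: "\<And>j e. H2sol (elen a b e) (\<psi> j e) (\<lambda>t. - (\<kappa>\<^sup>2 * \<psi> j e t))"
    and V: "vertex_conds a b (coup \<gamma> \<gamma>t) \<theta> \<psi>"
    using sol unfolding solves_def by simp_all
  note V' = V[unfolded vertex_conds_def, rule_format]
  have c: "\<psi> j Hor a = \<psi> j Up 0" "\<psi> (j+1) Hor 0 = \<psi> j Up 0" "\<psi> j Dn (b/2) = \<psi> j Up 0"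
     "- dv a (\<psi> j Hor) a + dv a (\<psi> (j+1) Hor) 0 + dv (b/2) (\<psi> j Up) 0 - dv (b/2) (\<psi> j Dn) (b/2)
        = complex_of_real (coup \<gamma> \<gamma>t j) * \<psi> j Up 0 + 0"
     "\<psi> j Up (b/2) = \<omega> * \<psi> j Dn 0" "dv (b/2) (\<psi> j Up) (b/2) = \<omega> * dv (b/2) (\<psi> j Dn) 0" for j
    using V'[of j] by auto
  note R = homogeneous_eq_graph_sol[where s = "\<lambda>_. 0" and c = "coup \<gamma> \<gamma>t", OF H c, folded y_def]
  show "\<psi> j e t = graph_sol (\<lambda>_ _ _. 0) y j e t" if "t \<in> {0..elen a b e}" for t
    using R(1)[OF that] .
  have eq: "\<psi> j Up t = graph_sol (\<lambda>_ _ _. 0) y j Up t" if "t \<in> {0..b/2}" for j t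
    using R(1)[of t Up j] that by (simp add: elen_def)
  have lim: "(\<lambda>n. y (int n)) \<longlonglongrightarrow> 0" "(\<lambda>n. y (- int n)) \<longlonglongrightarrow> 0"
    by (rule vertex_values_tendsto_0[OF L2 eq]; simp add: inj_int_minus)+
  show yz: "y j = z ^ nat \<bar>j\<bar> * y 0" for j
  proof (rule recurrence_unique[OF z(1) _ z(3) _ lim])
    show "cmod z \<le> 1" using z(2) by simp
    show "y (j + 1) + y (j - 1) = 2 * Fc (of_real \<gamma>) * y j" if "j \<noteq> 0" for j
      using R(2)[of j] that by (simp add: coup_def y_def)
  qed
  have "y 1 + y (- 1) - 2 * Fc (of_real \<gamma>t) * y 0 = 0"
    using R(2)[of 0] by (simp add: coup_def y_def)
  then show "(z - Fc (of_real \<gamma>t)) * y 0 = 0"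
    using yz[of 1] yz[of "-1"] by (simp add: algebra_simps)
qed

lemma graph_sol_homogeneous:
  assumes "\<And>j. y j = x * y' j"
  shows "graph_sol (\<lambda>_ _ _. 0) y j e t = x * graph_sol (\<lambda>_ _ _. 0) y' j e t"
  by (cases e) (simp_all add: assms Let_def esol_def hor_slope_def up_slope_def dn_value_def dn_slope_def algebra_simps)

lemma L2g_zero: "L2g a b (\<lambda>_ _ _. 0)"
  by (rule L2gI) (auto intro: sqint_continuous simp: edge_norm2_def)

lemma not_in_spectrum:
  assumes z: "z \<noteq> 0" "cmod z < 1" "z + 1/z = 2 * Fc (of_real \<gamma>)" and ne: "Fc (of_real \<gamma>t) \<noteq> z"
  shows "\<kappa>\<^sup>2 \<notin> specH a b (coup \<gamma> \<gamma>t) \<theta>"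
proof -
  have "\<exists>\<psi>. solves a b (coup \<gamma> \<gamma>t) \<theta> (\<kappa>\<^sup>2) \<psi> g" if g: "L2g a b g" for g
  proof -
    obtain y where y: "ell2 y"
      "\<And>j. y (j + 1) + y (j - 1) - 2 * (if j = 0 then Fc (of_real \<gamma>t) else Fc (of_real \<gamma>)) * y j = graph_source g j"
      using recurrence_solvable[OF z(2) z(1) z(3) ne ell2_graph_source[OF g]] by metis
    have "solves a b (coup \<gamma> \<gamma>t) \<theta> (\<kappa>\<^sup>2) (graph_sol g y) g"
    proof (rule solves_graph_sol[OF g y(1)])
      fix j
      show "y (j + 1) + y (j - 1) - 2 * Fc (of_real (coup \<gamma> \<gamma>t j)) * y j = graph_source g j"
        using y(2)[of j] by (cases "j = 0") (simp_all add: coup_def)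
    qed
    then show ?thesis by blast
  qed
  moreover have "zero_on_edges a b \<psi>" if sol: "solves a b (coup \<gamma> \<gamma>t) \<theta> (\<kappa>\<^sup>2) \<psi> (\<lambda>_ _ _. 0)" for \<psi>
  proof -
    note R = homogeneous_solution[OF sol z]
    have "\<psi> 0 Up 0 = 0" using R(3) ne by auto
    then have "\<psi> j Up 0 = 0 * 0" for j using R(1)[of j] by simp
    from graph_sol_homogeneous[of "\<lambda>j. \<psi> j Up 0", OF this]
    show ?thesis unfolding zero_on_edges_def using R(2) by simp
  qed
  ultimately show ?thesis unfolding specH_def by blast
qed

lemma eigenvalue:
  assumes z: "z \<noteq> 0" "cmod z < 1" "z + 1/z = 2 * Fc (of_real \<gamma>)" and eq: "Fc (of_real \<gamma>t) = z"
  defines "c \<equiv> coup \<gamma> \<gamma>t"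
  shows "\<kappa>\<^sup>2 \<in> specH a b c \<theta>"
    and "\<exists>\<psi>\<in>eigsp a b c \<theta> (\<kappa>\<^sup>2). \<not> zero_on_edges a b \<psi>"
    and "\<exists>F. finite F \<and> F \<subseteq> eigsp a b c \<theta> (\<kappa>\<^sup>2) \<and>
        (\<forall>psi\<in>eigsp a b c \<theta> (\<kappa>\<^sup>2). \<exists>co. \<forall>j e. \<forall>t\<in>{0..elen a b e}.
            psi j e t = (\<Sum>phi\<in>F. co phi * phi j e t))"
proof -
  \<comment> \<open>The decaying mode, normalised to 1 at vertex 0, so that the coefficient of an
    eigenfunction is its value at that vertex.\<close>
  define w where "w j = z ^ nat \<bar>j\<bar>" for j :: int
  define \<phi> where "\<phi> = graph_sol (\<lambda>_ _ _. 0) w"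
  have "solves a b c \<theta> (\<kappa>\<^sup>2) \<phi> (\<lambda>_ _ _. 0)"
    unfolding \<phi>_def
  proof (rule solves_graph_sol[OF L2g_zero])
    show "ell2 w" unfolding w_def by (rule ell2_power_abs[OF z(2)])
    fix j
    show "w (j + 1) + w (j - 1) - 2 * Fc (of_real (c j)) * w j = graph_source (\<lambda>_ _ _. 0) j"
      using power_abs_recurrence[OF z(1,3), of j "Fc (of_real \<gamma>t)"] eq
      by (cases "j = 0") (simp_all add: c_def coup_def w_def)
  qed
  then have \<phi>: "\<phi> \<in> eigsp a b c \<theta> (\<kappa>\<^sup>2)" by (simp add: eigsp_def)
  have "\<phi> 0 Up 0 = 1" by (simp add: \<phi>_def w_def)
  moreover have "0 \<in> {0..elen a b Up}" using elen_pos[of Up] by simp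
  ultimately have nz: "\<not> zero_on_edges a b \<phi>" unfolding zero_on_edges_def by (metis zero_neq_one)
  show "\<exists>\<psi>\<in>eigsp a b c \<theta> (\<kappa>\<^sup>2). \<not> zero_on_edges a b \<psi>" using \<phi> nz by blast
  show "\<kappa>\<^sup>2 \<in> specH a b c \<theta>" using \<phi> nz unfolding specH_def eigsp_def by blast
  show "\<exists>F. finite F \<and> F \<subseteq> eigsp a b c \<theta> (\<kappa>\<^sup>2) \<and>
        (\<forall>psi\<in>eigsp a b c \<theta> (\<kappa>\<^sup>2). \<exists>co. \<forall>j e. \<forall>t\<in>{0..elen a b e}.
            psi j e t = (\<Sum>phi\<in>F. co phi * phi j e t))"
  proof (intro exI[of _ "{\<phi>}"] conjI ballI)
    fix \<psi> assume "\<psi> \<in> eigsp a b c \<theta> (\<kappa>\<^sup>2)"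
    then have sol: "solves a b (coup \<gamma> \<gamma>t) \<theta> (\<kappa>\<^sup>2) \<psi> (\<lambda>_ _ _. 0)" by (simp add: eigsp_def c_def)
    note R = homogeneous_solution[OF sol z]
    have "\<psi> j Up 0 = \<psi> 0 Up 0 * w j" for j using R(1)[of j] by (simp add: w_def mult.commute)
    from graph_sol_homogeneous[of "\<lambda>j. \<psi> j Up 0", OF this] 
    have "\<forall>j e. \<forall>t\<in>{0..elen a b e}. \<psi> j e t = \<psi> 0 Up 0 * \<phi> j e t"
      using R(2) by (simp add: \<phi>_def)
    then show "\<exists>co. \<forall>j e. \<forall>t\<in>{0..elen a b e}. \<psi> j e t = (\<Sum>phi\<in>{\<phi>}. co phi * phi j e t)"
      by (intro exI[of _ "\<lambda>_. \<psi> 0 Up 0"]) simp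
  qed (use \<phi> in auto)
qed

text \<open>Inside the band a source on a single edge has no square-integrable response. The source is
  \<open>(H - \<kappa>\<^sup>2) v\<close> for a cubic \<open>v\<close> on the edge \<open>(Dn, 0)\<close> that satisfies every vertex condition
  except the one on the derivatives at \<open>x\<^sub>0\<close>, so that it acts as a unit flux there.\<close>

lemma band_in_spectrum:
  assumes z: "cmod z = 1" "z + 1/z = 2 * Fc (of_real \<gamma>)"
  shows "\<kappa>\<^sup>2 \<in> specH a b (coup \<gamma> \<gamma>) \<theta>"
proof (rule ccontr)
  assume ns: "\<kappa>\<^sup>2 \<notin> specH a b (coup \<gamma> \<gamma>) \<theta>"
  define l where "l = b/2"
  have l: "l > 0" using b_pos by (simp add: l_def)
  define L where "L = complex_of_real l"
  have Ln: "L \<noteq> 0" using l by (simp add: L_def)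
  \<comment> \<open>With these coefficients v t = t^2 (t - l) / l^2: the double zero at 0 preserves
    both quasi-periodic conditions, the simple zero at l has slope 1.\<close>
  define p q where "p = 1 / L\<^sup>2" and "q = 1 / L"
  define v where "v t = p * (of_real t)^3 - q * (of_real t)\<^sup>2" for t
  define v1 where "v1 t = p * (3 * (of_real t)\<^sup>2) - q * (2 * of_real t)" for t
  define v2 where "v2 t = p * (6 * of_real t) - q * 2" for t
  have d1: "(v has_vector_derivative v1 t) (at t within A)" for t A
    unfolding v_def[abs_def] v1_def
    by (rule has_vector_derivative_real_field[where f = "\<lambda>z. p * z^3 - q * z\<^sup>2"])
      (auto intro!: derivative_eq_intros)
  have d2: "(v1 has_vector_derivative v2 t) (at t within A)" for t A
    unfolding v1_def[abs_def] v2_def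
    by (rule has_vector_derivative_real_field[where f = "\<lambda>z. p * (3 * z\<^sup>2) - q * (2 * z)"])
      (auto intro!: derivative_eq_intros)
  have vc: "continuous_on {0..l} v" by (rule has_vector_derivative_continuous_on[OF d1])
  have v2c: "continuous_on {0..l} v2"
    unfolding v2_def[abs_def] by (intro continuous_intros)
  have Hv: "H2sol l v v2"
    unfolding H2sol_iff[OF sqint_continuous[OF v2c]]
  proof (intro exI[of _ v1] conjI ballI d1)
    fix t assume "t \<in> {0..l}"
    from prim_derivative[OF d2 this] show "v1 t = v1 0 + prim v2 t" by simp
  qed
  have v_ends: "v 0 = 0" "v l = 0" "v1 0 = 0" "v1 l = 1"
    using Ln by (simp_all add: v_def v1_def p_def q_def L_def[symmetric] field_simps power2_eq_square power3_eq_cube)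
  define D where "D j e \<longleftrightarrow> j = (0::int) \<and> e = Dn" for j e
  define g where "g j e t = (if D j e then - (v2 t + \<kappa>\<^sup>2 * v t) else 0)" for j e t
  have gc: "continuous_on {0..elen a b e} (g j e)" for j e
  proof (cases "D j e")
    case True
    then have "g j e = (\<lambda>t. - (v2 t + \<kappa>\<^sup>2 * v t))" "elen a b e = l"
      by (auto simp: g_def fun_eq_iff D_def elen_def l_def)
    then show ?thesis using vc v2c by (auto intro!: continuous_intros)
  next
    case False
    then have "g j e = (\<lambda>t. 0)" by (simp add: g_def fun_eq_iff)
    then show ?thesis by simp
  qed
  have "L2g a b g"
  proof (rule L2gI)
    show "sqint (elen a b e) (g j e)" for j e by (rule sqint_continuous[OF gc])
    show "(\<lambda>j. edge_norm2 (elen a b e) (g j e)) summable_on UNIV" for e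
    proof (rule summable_on_cong_neutral[THEN iffD1])
      show "(\<lambda>j. edge_norm2 (elen a b e) (g j e)) summable_on {0}" by simp
      show "edge_norm2 (elen a b e) (g j e) = 0" if "j \<in> UNIV - {0}" for j
        using that by (simp add: g_def D_def edge_norm2_def)
    qed auto
  qed
  with ns obtain \<psi> where sol: "solves a b (coup \<gamma> \<gamma>) \<theta> (\<kappa>\<^sup>2) \<psi> g" unfolding specH_def by blast
  have L2: "L2g a b \<psi>" and H: "\<And>j e. H2sol (elen a b e) (\<psi> j e) (\<lambda>t. - (g j e t + \<kappa>\<^sup>2 * \<psi> j e t))"
    and V: "vertex_conds a b (coup \<gamma> \<gamma>) \<theta> \<psi>"
    using sol unfolding solves_def by simp_all
  \<comment> \<open>Subtracting v removes the source from the edge; in exchange the vertex condition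
    at 0 acquires the flux s.\<close>
  define \<chi>' where "\<chi>' j e t = \<psi> j e t - (if D j e then v t else 0)" for j e t
  have nD: "\<chi>' j e = \<psi> j e" if "\<not> D j e" for j e using that by (simp add: \<chi>'_def fun_eq_iff)
  have yD: "\<chi>' j e = (\<lambda>t. \<psi> j e t - v t)" if "D j e" for j e using that by (simp add: \<chi>'_def fun_eq_iff)
  have H': "H2sol (elen a b e) (\<chi>' j e) (\<lambda>t. - (\<kappa>\<^sup>2 * \<chi>' j e t))" for j e
  proof (cases "D j e")
    case True
    then have el: "elen a b e = l" by (simp add: D_def elen_def l_def)
    have "H2sol l (\<lambda>t. \<psi> j e t - v t) (\<lambda>t. - (g j e t + \<kappa>\<^sup>2 * \<psi> j e t) - v2 t)"
      by (rule H2sol_diff[OF H[of e j, unfolded el] Hv])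
    moreover have "(\<lambda>t. - (g j e t + \<kappa>\<^sup>2 * \<psi> j e t) - v2 t) = (\<lambda>t. - (\<kappa>\<^sup>2 * (\<psi> j e t - v t)))"
      using True by (simp add: g_def fun_eq_iff algebra_simps)
    ultimately show ?thesis unfolding el yD[OF True] by simp
  next
    case False
    then show ?thesis using H[of e j] by (simp add: nD g_def)
  qed
  note V' = V[unfolded vertex_conds_def, rule_format]
  have nD': "\<chi>' j Up = \<psi> j Up" "\<chi>' j Hor = \<psi> j Hor" for j by (rule nD, simp add: D_def)+
  have dvD: "dv (b/2) (\<chi>' j Dn) t = dv (b/2) (\<psi> j Dn) t - (if j = 0 then v1 t else 0)" if t: "t \<in> {0..b/2}" for j t
  proof (cases "j = 0")
    case True
    then have D: "D j Dn" by (simp add: D_def)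
    have b2: "b/2 > 0" using b_pos by simp
    have "dv (b/2) (\<chi>' j Dn) t = dv (b/2) (\<psi> j Dn) t - v1 t"
      unfolding yD[OF D]
      by (rule dv_eq[OF has_vector_derivative_diff[OF H2sol_has_vector_derivative[OF H[of Dn j, unfolded elen_def etype.case] t b2] d1] t b2])
    then show ?thesis using True by simp
  next
    case False
    then show ?thesis using nD[of j Dn] by (simp add: D_def)
  qed
  have ends: "\<chi>' j Dn (b/2) = \<psi> j Dn (b/2)" "\<chi>' j Dn 0 = \<psi> j Dn 0" for j
    using v_ends by (simp_all add: \<chi>'_def l_def)
  have dends: "dv (b/2) (\<chi>' j Dn) (b/2) = dv (b/2) (\<psi> j Dn) (b/2) - (if j = 0 then 1 else 0)"
    "dv (b/2) (\<chi>' j Dn) 0 = dv (b/2) (\<psi> j Dn) 0" for j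
    using dvD[of "b/2" j] dvD[of 0 j] v_ends b_pos by (simp_all add: l_def)
  define s :: "int \<Rightarrow> complex" where "s j = (if j = 0 then 1 else 0)" for j
  have c: "\<chi>' j Hor a = \<chi>' j Up 0" "\<chi>' (j+1) Hor 0 = \<chi>' j Up 0" "\<chi>' j Dn (b/2) = \<chi>' j Up 0"
     "- dv a (\<chi>' j Hor) a + dv a (\<chi>' (j+1) Hor) 0 + dv (b/2) (\<chi>' j Up) 0 - dv (b/2) (\<chi>' j Dn) (b/2)
        = complex_of_real (coup \<gamma> \<gamma> j) * \<chi>' j Up 0 + s j"
     "\<chi>' j Up (b/2) = \<omega> * \<chi>' j Dn 0" "dv (b/2) (\<chi>' j Up) (b/2) = \<omega> * dv (b/2) (\<chi>' j Dn) 0" for j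
    using V'[of j] unfolding nD' ends dends s_def by (auto simp: algebra_simps)
  define y where "y j = \<chi>' j Up 0" for j
  note R = homogeneous_eq_graph_sol[where s = s and c = "coup \<gamma> \<gamma>", OF H' c, folded y_def]
  have eq: "\<psi> j Up t = graph_sol (\<lambda>_ _ _. 0) y j Up t" if "t \<in> {0..b/2}" for j t
    using R(1)[of t Up j] that by (simp add: elen_def nD' y_def[abs_def])
  have lim: "(\<lambda>n. y (int n)) \<longlonglongrightarrow> 0" "(\<lambda>n. y (- int n)) \<longlonglongrightarrow> 0"
    by (rule vertex_values_tendsto_0[OF L2 eq]; simp add: inj_int_minus)+
  have yz: "y j = z ^ nat \<bar>j\<bar> * y 0" for j
  proof (rule recurrence_unique[OF _ _ z(2) _ lim])
    show "z \<noteq> 0" "cmod z \<le> 1" using z(1) by auto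
    show "y (j + 1) + y (j - 1) = 2 * Fc (of_real \<gamma>) * y j" if "j \<noteq> 0" for j
      using R(2)[of j] that by (simp add: coup_def s_def)
  qed
  \<comment> \<open>On the unit circle |y| is constant along the half-line, so decay forces y = 0;
    the equation at 0 would then read 0 = Sa.\<close>
  have "cmod (y (int n)) = cmod (y 0)" for n
    using yz[of "int n"] z(1) by (simp add: norm_mult norm_power)
  with tendsto_norm_zero[OF lim(1)] have "y 0 = 0" by (simp add: LIMSEQ_const_iff)
  then have "y j = 0" for j using yz[of j] by simp
  then show False using R(2)[of 0] Sa_nz by (simp add: s_def)
qed

end


subsection \<open>Isolation of the eigenvalue\<close>

text \<open>\<open>Fc\<close> with \<kappa> as an argument: the locale fixes \<kappa>, while limits
  near k need it to vary.\<close>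

definition discriminant :: "real \<Rightarrow> real \<Rightarrow> real \<Rightarrow> real \<Rightarrow> complex \<Rightarrow> complex" where
  "discriminant a b \<tau> \<gamma> \<kappa> = of_real \<gamma> * sin (\<kappa> * of_real a) / (2 * \<kappa>) + cos (\<kappa> * of_real a)
     + sin (\<kappa> * of_real a) * (cos (\<kappa> * of_real b) - of_real \<tau>) / sin (\<kappa> * of_real b)"

lemma (in comb) Fc_eq_discriminant: "Fc (of_real \<gamma>) = discriminant a b (cos \<theta>) \<gamma> \<kappa>"
  using \<kappa>_nz by (simp add: Fc_def discriminant_def cs_def sn_def)

lemma discriminant_of_real:
  assumes "sin (k * b) \<noteq> 0"
  shows "discriminant a b \<tau> \<gamma> (of_real k) = of_real (ff a b \<gamma> \<tau> k)"
proof -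
  have "ff a b \<gamma> \<tau> k = \<gamma> * sin (k * a) / (2 * k) + cos (k * a) + sin (k * a) * (cos (k * b) - \<tau>) / sin (k * b)"
    using assms by (simp add: ff_def distrib_left sin_add field_simps)
  then show ?thesis
    unfolding discriminant_def of_real_mult[symmetric] sin_of_real cos_of_real by simp
qed

text \<open>The function \<open>eigfun\<close> is \<open>(2 \<kappa> sin \<kappa>b)\<^sup>2 (Ft\<^sup>2 - 2 F Ft + 1)\<close> with the denominators cleared, where
  \<open>F\<close> and \<open>Ft\<close> are the discriminants for the two couplings.\<close>

definition eigfun :: "real \<Rightarrow> real \<Rightarrow> real \<Rightarrow> real \<Rightarrow> real \<Rightarrow> complex \<Rightarrow> complex" where
  "eigfun a b \<tau> \<gamma> \<gamma>t \<kappa> =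
     (of_real (\<gamma>t - \<gamma>) * sin (\<kappa> * of_real a) * sin (\<kappa> * of_real b))\<^sup>2 + 4 * \<kappa>\<^sup>2 * (sin (\<kappa> * of_real b))\<^sup>2
     - (of_real \<gamma> * sin (\<kappa> * of_real a) * sin (\<kappa> * of_real b)
        + 2 * \<kappa> * (cos (\<kappa> * of_real a) * sin (\<kappa> * of_real b)
           + sin (\<kappa> * of_real a) * (cos (\<kappa> * of_real b) - of_real \<tau>)))\<^sup>2"

text \<open>Completing the square, z^2 - 2 F z + 1 = (z - F)^2 + 1 - F^2. With z = Ft the difference
  z - F contains only the change of coupling, which explains the first square in
  \<open>eigfun\<close>.\<close>

lemma eigfun_eq_0:
  assumes "\<kappa> \<noteq> 0" "sin (\<kappa> * of_real b) \<noteq> 0" "z \<noteq> 0"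
    and z: "z + 1/z = 2 * discriminant a b \<tau> \<gamma> \<kappa>" "discriminant a b \<tau> \<gamma>t \<kappa> = z"
  shows "eigfun a b \<tau> \<gamma> \<gamma>t \<kappa> = 0"
proof -
  define F where "F = discriminant a b \<tau> \<gamma> \<kappa>"
  define A where "A = sin (\<kappa> * of_real a)"
  define B where "B = sin (\<kappa> * of_real b)"
  have B: "B \<noteq> 0" using assms by (simp add: B_def)
  have 1: "2 * \<kappa> * B * (z - F) = of_real (\<gamma>t - \<gamma>) * A * B"
    using assms(1) B unfolding F_def z(2)[symmetric] discriminant_def A_def[symmetric] B_def[symmetric]
    by (simp add: field_simps)
  have 2: "2 * \<kappa> * B * F = of_real \<gamma> * A * B + 2 * \<kappa> * (cos (\<kappa> * of_real a) * B + A * (cos (\<kappa> * of_real b) - of_real \<tau>))"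
    using assms(1) B unfolding F_def discriminant_def A_def[symmetric] B_def[symmetric]
    by (simp add: field_simps)
  have 3: "z\<^sup>2 - 2 * F * z + 1 = 0"
    unfolding F_def z(1)[symmetric] using assms(3) by (simp add: field_simps power2_eq_square)
  have "eigfun a b \<tau> \<gamma> \<gamma>t \<kappa> = (2 * \<kappa> * B * (z - F))\<^sup>2 + 4 * \<kappa>\<^sup>2 * B\<^sup>2 - (2 * \<kappa> * B * F)\<^sup>2"
    unfolding 1 2 unfolding eigfun_def A_def B_def by (rule refl)
  also have "\<dots> = 4 * \<kappa>\<^sup>2 * B\<^sup>2 * (z\<^sup>2 - 2 * F * z + 1)"
    by (simp add: algebra_simps power2_eq_square)
  finally show ?thesis unfolding 3 by simp
qed

lemma sin_imaginary: "sin (\<i> * complex_of_real x) = \<i> * of_real (sinh x)"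
  by (simp add: sin_exp_eq sinh_field_def exp_minus scaleR_conv_of_real exp_of_real[symmetric] field_simps)

lemma cos_imaginary: "cos (\<i> * complex_of_real x) = of_real (cosh x)"
  by (simp add: cos_exp_eq cosh_field_def exp_minus scaleR_conv_of_real exp_of_real[symmetric] field_simps)

lemma sinh_ge: "x \<ge> 0 \<Longrightarrow> sinh x \<ge> (x::real)"
proof -
  assume x: "x \<ge> 0"
  have "sinh 0 - 0 \<le> sinh x - x"
  proof (rule DERIV_nonneg_imp_nondecreasing[OF x])
    fix t :: real
    show "\<exists>y. ((\<lambda>x. sinh x - x) has_real_derivative y) (at t) \<and> 0 \<le> y"
      by (rule exI[of _ "cosh t - 1"]) (auto intro!: derivative_eq_intros simp: cosh_real_ge_1)
  qed
  then show ?thesis by simp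
qed

lemma eigfun_nonzero:
  assumes "a > 0" "b > 0" "\<tau> \<le> 1"
  shows "\<exists>\<kappa>. eigfun a b \<tau> \<gamma> \<gamma>t \<kappa> \<noteq> 0"
proof -
  define \<delta> where "\<delta> = \<gamma>t - \<gamma>"
  \<comment> \<open>The summand 2/a gives A \<ge> 2 and hence 4 t^2 B^2 \<le> t^2 (A B)^2; the
    others give t - |\<gamma>| > |\<delta>| and hence (2 t + \<gamma>)^2 > t^2 + \<delta>^2.
    Together these let X^2 dominate.\<close>
  define t where "t = \<bar>\<gamma>\<bar> + \<bar>\<delta>\<bar> + 2/a + 1"
  have t0: "t > 0" and ta: "t * a \<ge> 2" and tg: "t - \<bar>\<gamma>\<bar> > \<bar>\<delta>\<bar>"
    using assms by (auto simp: t_def field_simps add_pos_nonneg add_nonneg_pos)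
  define A B where "A = sinh (t * a)" and "B = sinh (t * b)"
  have A: "A \<ge> 2" using sinh_ge[of "t * a"] ta by (simp add: A_def)
  have B: "B > 0" using t0 assms by (simp add: B_def)
  define X where "X = \<gamma> * A * B + 2 * t * (cosh (t * a) * B + A * (cosh (t * b) - \<tau>))"
  \<comment> \<open>On the imaginary axis sines become \<open>\<i>\<close> times sinh, so all three
    squares are real; the last bracket of \<open>eigfun\<close> equals - X.\<close>
  have "eigfun a b \<tau> \<gamma> \<gamma>t (\<i> * of_real t) = of_real ((\<delta> * A * B)\<^sup>2 + 4 * t\<^sup>2 * B\<^sup>2 - X\<^sup>2)"
    unfolding eigfun_def mult.assoc[of \<i>] of_real_mult[symmetric] sin_imaginary cos_imaginary
      A_def[symmetric] B_def[symmetric] \<delta>_def[symmetric] X_def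
    by (simp add: power2_eq_square algebra_simps)
  moreover have "(\<delta> * A * B)\<^sup>2 + 4 * t\<^sup>2 * B\<^sup>2 < X\<^sup>2"
  proof -
    have g: "2 * t + \<gamma> \<ge> t + (t - \<bar>\<gamma>\<bar>)" by simp
    have "cosh (t * a) * B \<ge> A * B"
      using B sinh_le_cosh_real[of "t * a"] by (intro mult_right_mono) (auto simp: A_def)
    moreover have "A * (cosh (t * b) - \<tau>) \<ge> 0"
      using A cosh_real_ge_1[of "t * b"] assms(3) by (intro mult_nonneg_nonneg) auto
    ultimately have "cosh (t * a) * B + A * (cosh (t * b) - \<tau>) \<ge> A * B" by linarith
    from mult_left_mono[OF this, of "2 * t"] t0
    have "X \<ge> (2 * t + \<gamma>) * (A * B)" by (simp add: X_def algebra_simps)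
    then have X: "((2 * t + \<gamma>) * (A * B))\<^sup>2 \<le> X\<^sup>2"
      using A B t0 g tg by (intro power_mono) (auto intro!: mult_nonneg_nonneg)
    have "\<delta>\<^sup>2 < (t - \<bar>\<gamma>\<bar>)\<^sup>2" using tg by (metis abs_ge_zero power2_abs power_strict_mono zero_less_numeral)
    moreover have "0 \<le> t * (t - \<bar>\<gamma>\<bar>)" using t0 tg by (intro mult_nonneg_nonneg) auto
    moreover have "(t + (t - \<bar>\<gamma>\<bar>))\<^sup>2 \<le> (2 * t + \<gamma>)\<^sup>2" using g t0 tg by (intro power_mono) auto
    moreover have "(t + (t - \<bar>\<gamma>\<bar>))\<^sup>2 = t\<^sup>2 + (t - \<bar>\<gamma>\<bar>)\<^sup>2 + 2 * (t * (t - \<bar>\<gamma>\<bar>))"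
      by (simp only: power2_sum mult.assoc)
    ultimately have "t\<^sup>2 + \<delta>\<^sup>2 < (2 * t + \<gamma>)\<^sup>2" by linarith
    then have "(t\<^sup>2 + \<delta>\<^sup>2) * (A * B)\<^sup>2 < (2 * t + \<gamma>)\<^sup>2 * (A * B)\<^sup>2"
      using A B by (intro mult_strict_right_mono) auto
    moreover have "4 * t\<^sup>2 * B\<^sup>2 \<le> t\<^sup>2 * (A * B)\<^sup>2"
    proof -
      have "2\<^sup>2 \<le> A\<^sup>2" by (rule power_mono[OF A]) simp
      then have "4 * (t\<^sup>2 * B\<^sup>2) \<le> A\<^sup>2 * (t\<^sup>2 * B\<^sup>2)" by (intro mult_right_mono) auto
      then show ?thesis by (simp add: power_mult_distrib mult_ac)
    qed
    moreover have "(\<delta> * A * B)\<^sup>2 = \<delta>\<^sup>2 * (A * B)\<^sup>2" by (simp add: power_mult_distrib)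
    ultimately show ?thesis
      using X unfolding power_mult_distrib[of "2 * t + \<gamma>" "A * B"] distrib_right[of "t\<^sup>2"] by linarith
  qed
  ultimately have "eigfun a b \<tau> \<gamma> \<gamma>t (\<i> * of_real t) \<noteq> 0" by (simp only: of_real_eq_0_iff)
  then show ?thesis by blast
qed

lemma eventually_eigfun_nonzero:
  assumes "a > 0" "b > 0" "\<tau> \<le> 1"
  shows "\<forall>\<^sub>F \<kappa> in at \<kappa>0. eigfun a b \<tau> \<gamma> \<gamma>t \<kappa> \<noteq> 0"
proof -
  obtain \<beta> where \<beta>: "eigfun a b \<tau> \<gamma> \<gamma>t \<beta> \<noteq> 0" using eigfun_nonzero[OF assms] by blast
  have hol: "eigfun a b \<tau> \<gamma> \<gamma>t holomorphic_on UNIV"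
    unfolding eigfun_def[abs_def] by (intro holomorphic_intros)
  have "\<forall>\<^sub>F w in at \<kappa>0. eigfun a b \<tau> \<gamma> \<gamma>t w \<noteq> 0 \<and> w \<in> UNIV"
    by (rule non_zero_neighbour_alt[OF hol _ _ _ UNIV_I \<beta>]) auto
  then show ?thesis by simp
qed

section \<open>Roots inside the unit circle and passage to the energy plane\<close>

text \<open>The two roots have product 1, so one lies inside the unit circle unless both lie on it;
  then they are conjugate and 2 F is twice a real part, which puts F in [-1, 1].\<close>

lemma contracting_root:
  assumes "F \<notin> complex_of_real ` {-1..1}"
  obtains z where "z \<noteq> 0" "cmod z < 1" "z + 1/z = 2 * F"
proof -
  define w where "w = F + csqrt (F\<^sup>2 - 1)"
  have "(w - F)\<^sup>2 = F\<^sup>2 - 1" by (simp add: w_def)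
  then have q: "w * (2 * F - w) = 1" by (simp add: power2_eq_square algebra_simps)
  then have w0: "w \<noteq> 0" by auto
  with q have r: "w + 1/w = 2 * F" by (simp add: field_simps)
  consider "cmod w < 1" | "cmod w > 1" | "cmod w = 1" by linarith
  then show thesis
  proof cases
    case 1 with that w0 r show ?thesis by blast
  next
    case 2
    then show ?thesis using that[of "1/w"] w0 r by (simp add: norm_divide field_simps)
  next
    case 3
    then have "1 / w = cnj w" using complex_div_cnj[of 1 w] by simp
    with r have "2 * F = of_real (2 * Re w)" using complex_add_cnj[of w] by simp
    then have "F = of_real (Re w)" by simp
    moreover have "\<bar>Re w\<bar> \<le> 1" using abs_Re_le_cmod[of w] 3 by simp
    ultimately show ?thesis using assms by (auto simp: abs_le_iff)
  qed
qed

text \<open>Near k the nonvanishing of the sines and F outside [-1, 1] persist by continuity, while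
  Ft = z is excluded off k by the isolated zeros of \<open>eigfun\<close>.\<close>

lemma eventually_not_in_spectrum:
  assumes ab: "a > 0" "b > 0" and k: "k > 0" "sin (k * a) \<noteq> 0" "sin (k * b) \<noteq> 0"
    and out: "\<bar>ff a b \<gamma> (cos \<theta>) k\<bar> > 1"
  shows "\<forall>\<^sub>F \<mu> in at (complex_of_real (k\<^sup>2)). \<mu> \<notin> specH a b (coup \<gamma> \<gamma>t) \<theta>"
proof -
  let ?k = "complex_of_real k"
  have nz: "?k \<noteq> 0" "sin (?k * of_real a) \<noteq> 0" "sin (?k * of_real b) \<noteq> 0"
    using k by (auto simp: sin_of_real simp flip: of_real_mult)
  have e1: "\<forall>\<^sub>F \<kappa> in at ?k. \<kappa> \<noteq> 0"
    by (rule tendsto_imp_eventually_ne[OF tendsto_ident_at nz(1)])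
  have e2: "\<forall>\<^sub>F \<kappa> in at ?k. sin (\<kappa> * of_real a) \<noteq> 0"
    by (rule tendsto_imp_eventually_ne[OF _ nz(2)]) (intro tendsto_intros)
  have e3: "\<forall>\<^sub>F \<kappa> in at ?k. sin (\<kappa> * of_real b) \<noteq> 0"
    by (rule tendsto_imp_eventually_ne[OF _ nz(3)]) (intro tendsto_intros)
  have "(discriminant a b (cos \<theta>) \<gamma> \<longlongrightarrow> discriminant a b (cos \<theta>) \<gamma> ?k) (at ?k)"
    unfolding discriminant_def[abs_def] by (intro tendsto_intros) (use nz in auto)
  moreover have "open (- (complex_of_real ` {-1..1}))"
    by (intro open_Compl compact_imp_closed compact_continuous_image continuous_intros) auto
  moreover have "discriminant a b (cos \<theta>) \<gamma> ?k \<in> - (complex_of_real ` {-1..1})"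
    using out unfolding discriminant_of_real[OF k(3)] by auto
  ultimately have e4: "\<forall>\<^sub>F \<kappa> in at ?k. discriminant a b (cos \<theta>) \<gamma> \<kappa> \<in> - (complex_of_real ` {-1..1})"
    by (rule topological_tendstoD)
  have e5: "\<forall>\<^sub>F \<kappa> in at ?k. eigfun a b (cos \<theta>) \<gamma> \<gamma>t \<kappa> \<noteq> 0"
    by (rule eventually_eigfun_nonzero[OF ab]) simp
  have e: "\<forall>\<^sub>F \<kappa> in at ?k. \<kappa>\<^sup>2 \<notin> specH a b (coup \<gamma> \<gamma>t) \<theta>"
    using e1 e2 e3 e4 e5
  proof eventually_elim
    case (elim \<kappa>)
    interpret comb a b \<theta> \<kappa> by unfold_locales (use ab elim in auto)
    obtain z where z: "z \<noteq> 0" "cmod z < 1" "z + 1/z = 2 * discriminant a b (cos \<theta>) \<gamma> \<kappa>"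
      by (rule contracting_root) (use elim in auto)
    show ?case
    proof (rule not_in_spectrum[OF z[folded Fc_eq_discriminant]])
      show "Fc (of_real \<gamma>t) \<noteq> z"
        unfolding Fc_eq_discriminant using eigfun_eq_0[OF _ _ z(1) z(3)] elim by blast
    qed
  qed
  have sq: "csqrt (of_real (k\<^sup>2)) = ?k" using k(1) by (simp add: csqrt_of_real_nonneg)
  \<comment> \<open>The principal root transports the statement from \<kappa> to \<mu> = \<kappa>^2:
    k^2 > 0 lies off the branch cut, and \<mu> different from k^2 has a root different from
    k.\<close>
  have "filterlim csqrt (at ?k) (at (of_real (k\<^sup>2)))"
  proof (rule filterlim_atI)
    have "isCont csqrt (of_real (k\<^sup>2))"
      by (rule continuous_at_csqrt) (use k(1) in \<open>auto simp: complex_nonpos_Reals_iff\<close>)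
    then show "(csqrt \<longlongrightarrow> ?k) (at (of_real (k\<^sup>2)))" unfolding isCont_def sq .
    have "csqrt \<mu> \<noteq> ?k" if "\<mu> \<noteq> of_real (k\<^sup>2)" for \<mu>
      using that by (metis of_real_power power2_csqrt)
    then show "\<forall>\<^sub>F \<mu> in at (of_real (k\<^sup>2)). csqrt \<mu> \<noteq> ?k"
      by (auto simp: eventually_at_filter)
  qed
  from eventually_compose_filterlim[OF e this] show ?thesis by simp
qed

text \<open>The square root is given the sign opposite to f, so in the other root 2 f - z the two
  terms reinforce each other and its modulus exceeds 1; the product of the roots is 1.\<close>

lemma real_contracting_root:
  fixes f :: real
  assumes "\<bar>f\<bar> > 1"
  defines "z \<equiv> if f < -1 then f + sqrt (f\<^sup>2 - 1) else f - sqrt (f\<^sup>2 - 1)"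
  shows "z \<noteq> 0" "\<bar>z\<bar> < 1" "z + 1/z = 2 * f"
proof -
  define s where "s = sqrt (f\<^sup>2 - 1)"
  have "f\<^sup>2 > 1" using assms(1) one_less_power[of "\<bar>f\<bar>" 2] by simp
  then have s: "s > 0" "s\<^sup>2 = f\<^sup>2 - 1" by (simp_all add: s_def)
  have q: "z * (2 * f - z) = 1"
    using s(2) unfolding z_def s_def[symmetric] by (auto simp: algebra_simps power2_eq_square)
  then show z0: "z \<noteq> 0" by auto
  with q show "z + 1/z = 2 * f" by (simp add: field_simps)
  have "\<bar>2 * f - z\<bar> > 1" using s(1) assms(1) by (auto simp: z_def s_def[symmetric])
  moreover have "\<bar>z\<bar> * \<bar>2 * f - z\<bar> = 1" by (metis q abs_mult abs_one)
  ultimately show "\<bar>z\<bar> < 1"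
    by (metis abs_ge_zero linorder_not_le mult_le_cancel_right1 not_one_le_zero order.strict_trans1 zero_less_one)
qed

theorem theorem3p2:
  fixes a b \<gamma> \<gamma>t \<theta> E k \<tau> :: real
  assumes "a > 0" and "b > 0"
    and "\<theta> \<in> {-pi..pi}"
    and "\<tau> = cos \<theta>"
    and "E > 0"
    and "complex_of_real E \<notin> specHg a b \<gamma> \<gamma> \<theta>"
    and "k = sqrt E"
    and "k \<notin> Xi a b"
  shows "complex_of_real E \<in> disc_specHg a b \<gamma> \<gamma>t \<theta> \<longleftrightarrow>
    (ff a b \<gamma>t \<tau> k =
      (if ff a b \<gamma> \<tau> k < -1 then ff a b \<gamma> \<tau> k + sqrt ((ff a b \<gamma> \<tau> k)^2 - 1)
       else ff a b \<gamma> \<tau> k - sqrt ((ff a b \<gamma> \<tau> k)^2 - 1)))"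
proof -
  have k: "k > 0" "k\<^sup>2 = E" using assms by simp_all
  have s: "sin (k * a) \<noteq> 0" "sin (k * b) \<noteq> 0" using assms(8) k by (auto simp: Xi_def)
  interpret comb a b \<theta> "complex_of_real k"
    by unfold_locales (use assms(1,2) k s in \<open>auto simp: sin_of_real simp flip: of_real_mult\<close>)
  have E: "complex_of_real E = (complex_of_real k)\<^sup>2" using k by (simp flip: of_real_power)
  have Fc: "Fc (of_real g) = of_real (ff a b g \<tau> k)" for g
    unfolding Fc_eq_discriminant assms(4) by (rule discriminant_of_real[OF s(2)])
  define f where "f = ff a b \<gamma> \<tau> k"
  have f: "\<bar>f\<bar> > 1"
  proof (rule ccontr)
    assume "\<not> \<bar>f\<bar> > 1"
    then have "f\<^sup>2 \<le> 1" by (simp add: abs_square_le_1)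
    \<comment> \<open>For |f| \<le> 1, band edges included, the root lies on the unit circle with
      real part f, so z + 1/z = 2 Re z = 2 f.\<close>
    define z where "z = Complex f (sqrt (1 - f\<^sup>2))"
    have z: "cmod z = 1" using \<open>f\<^sup>2 \<le> 1\<close> by (simp add: z_def cmod_def)
    then have "1 / z = cnj z" using complex_div_cnj[of 1 z] by simp
    then have "z + 1/z = 2 * Fc (of_real \<gamma>)"
      unfolding Fc f_def[symmetric] using complex_add_cnj[of z] by (simp add: z_def)
    from band_in_spectrum[OF z this] show False
      using assms(6) unfolding specHg_def E by blast
  qed
  define z where "z = (if f < -1 then f + sqrt (f\<^sup>2 - 1) else f - sqrt (f\<^sup>2 - 1))"
  note zr = real_contracting_root[OF f, folded z_def]
  have z: "complex_of_real z \<noteq> 0" "cmod (of_real z) < 1" "of_real z + 1 / of_real z = 2 * Fc (of_real \<gamma>)"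
    using zr(1,2) arg_cong[OF zr(3), of complex_of_real] by (simp_all add: Fc f_def)
  have "complex_of_real E \<in> disc_specHg a b \<gamma> \<gamma>t \<theta> \<longleftrightarrow> Fc (of_real \<gamma>t) = of_real z"
  proof
    assume "complex_of_real E \<in> disc_specHg a b \<gamma> \<gamma>t \<theta>"
    then have "(complex_of_real k)\<^sup>2 \<in> specH a b (coup \<gamma> \<gamma>t) \<theta>"
      unfolding disc_specHg_def disc_specH_def E by blast
    \<comment> \<open>Any value of the perturbed discriminant other than z would make E a resolvent
      point, so membership in the spectrum already forces the equation.\<close>
    with not_in_spectrum[OF z] show "Fc (of_real \<gamma>t) = of_real z" by blast
  next
    assume "Fc (of_real \<gamma>t) = of_real z"
    note ev = eigenvalue[OF z this]
    have "\<forall>\<^sub>F \<mu> in at (complex_of_real E). \<mu> \<notin> specH a b (coup \<gamma> \<gamma>t) \<theta>"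
      using eventually_not_in_spectrum[OF assms(1,2) k(1) s, of \<gamma> \<theta> \<gamma>t] f
      unfolding f_def assms(4) k(2) by blast
    then have "\<exists>\<epsilon>>0. \<forall>\<mu>. \<mu> \<noteq> complex_of_real E \<and> cmod (\<mu> - of_real E) < \<epsilon> \<longrightarrow> \<mu> \<notin> specH a b (coup \<gamma> \<gamma>t) \<theta>"
      unfolding eventually_at dist_norm by blast
    with ev show "complex_of_real E \<in> disc_specHg a b \<gamma> \<gamma>t \<theta>"
      unfolding disc_specHg_def disc_specH_def E by blast
  qed
  then show ?thesis unfolding Fc of_real_eq_iff z_def f_def .
qed

end
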